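(* Let $A=(a_{ik})$ be a real symmetric $n\times n$ matrix whose induced signed graph $\Gamma=(T,\sigma)$, $T=(V,E)$, has no cycle. Let $\lambda_k$ be the $k$-th eigenvalue of $A$, of multiplicity $r$, with $$\lambda_1\le\cdots\le\lambda_{k-1}<\lambda_k=\cdots=\lambda_{k+r-1}<\lambda_{k+r}\le\cdots\le\lambda_n$$ (the strict inequalities being vacuous when the corresponding index is out of range), and let $f_k$ be an eigenfunction for $\lambda_k$. Let $\mathcal{F}=\{x\in V: f_k(x)=0\text{ and }f_k(y)=0\text{ for all }y\sim x\}$, let $\overline{\mathfrak{S}}(f_k)$ be the number of strong nodal domains of $f_k$ on $-\Gamma=(T,-\sigma)$, and let $\tilde r$ be the multiplicity of $\lambda_k$ as an eigenvalue of the matrix $\widetilde A$ obtained from $A$ by deleting all rows and columns with indices in $\mathcal F$. Then $r\ge\tilde r$ and there are nonnegative integers $c_1,c_2$ with $c_1+c_2+(r-\tilde r)=|\mathcal F|$ such that $$\mathfrak{S}(f_k)=k+r-1-|\mathcal F|+c_1,\qquad \overline{\mathfrak{S}}(f_k)=n-k+1-|\mathcal F|+c_2.$$ In particular, when $\mathcal F=\emptyset$, $\mathfrak{S}(f_k)=k+r-1$ and $\overline{\mathfrak{S}}(f_k)=n-k+1$.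
   Context: The induced signed graph of a real symmetric $n\times n$ matrix $A$ has vertex set $V=\{x_1,\dots,x_n\}$ (identified with indices), edge $\{x_i,x_j\}$ iff $i\ne j$ and $a_{ij}\ne0$, and sign $\sigma_{x_ix_j}=-a_{ij}/|a_{ij}|$. Eigenvalues are listed with multiplicity in nondecreasing order; eigenfunctions are nonzero eigenvectors viewed as functions on $V$. A walk is $y_1,\dots,y_m$ ($m\ge2$) with consecutive vertices adjacent; for $f:V\to\mathbb R$ and a signature $\sigma$, an S-walk is a walk with $f(y_j)\sigma_{y_jy_{j+1}}f(y_{j+1})>0$ for all $j$. The strong nodal domains of $f$ on $(T,\sigma)$ are the induced subgraphs on the equivalence classes of the relation on $\{x:f(x)\ne0\}$ "$x=y$ or an S-walk connects $x$ and $y$"; $\mathfrak{S}(f)$ denotes their number on $\Gamma=(T,\sigma)$. *)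

theory Defs
  imports "Jordan_Normal_Form.Char_Poly" "Jordan_Normal_Form.DL_Submatrix"
begin

text \<open>Eigenvalues of a square real matrix listed with (algebraic) multiplicity in
nondecreasing order: the unique sorted list whose linear factors multiply to the
characteristic polynomial (exists for real symmetric matrices).\<close>
definition eigvals_list :: "real mat \<Rightarrow> real list" where
  "eigvals_list A = (THE ls. sorted ls \<and> char_poly A = (\<Prod>a\<leftarrow>ls. [:- a, 1:]))"

definition adj :: "real mat \<Rightarrow> nat \<Rightarrow> nat \<Rightarrow> bool" where
  "adj A i j \<longleftrightarrow> i < dim_row A \<and> j < dim_row A \<and> i \<noteq> j \<and> A $$ (i, j) \<noteq> 0"

definition sig :: "real mat \<Rightarrow> nat \<Rightarrow> nat \<Rightarrow> real" where
  "sig A i j = - (A $$ (i, j)) / \<bar>A $$ (i, j)\<bar>"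

definition has_cycle :: "real mat \<Rightarrow> bool" where
  "has_cycle A \<longleftrightarrow> (\<exists>cs. length cs \<ge> 3 \<and> distinct cs
      \<and> (\<forall>j. Suc j < length cs \<longrightarrow> adj A (cs ! j) (cs ! Suc j))
      \<and> adj A (last cs) (hd cs))"

definition is_walk :: "real mat \<Rightarrow> nat list \<Rightarrow> bool" where
  "is_walk A ys \<longleftrightarrow> length ys \<ge> 2 \<and> (\<forall>j. Suc j < length ys \<longrightarrow> adj A (ys ! j) (ys ! Suc j))"

definition S_walk :: "real mat \<Rightarrow> (nat \<Rightarrow> nat \<Rightarrow> real) \<Rightarrow> (nat \<Rightarrow> real) \<Rightarrow> nat list \<Rightarrow> bool" where
  "S_walk A s f ys \<longleftrightarrow> is_walk A ys \<and>
     (\<forall>j. Suc j < length ys \<longrightarrow> f (ys ! j) * s (ys ! j) (ys ! Suc j) * f (ys ! Suc j) > 0)"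

definition nonzero_set :: "real mat \<Rightarrow> (nat \<Rightarrow> real) \<Rightarrow> nat set" where
  "nonzero_set A f = {x. x < dim_row A \<and> f x \<noteq> 0}"

definition strong_rel :: "real mat \<Rightarrow> (nat \<Rightarrow> nat \<Rightarrow> real) \<Rightarrow> (nat \<Rightarrow> real) \<Rightarrow> (nat \<times> nat) set" where
  "strong_rel A s f = {(x, y). x \<in> nonzero_set A f \<and> y \<in> nonzero_set A f \<and>
      (x = y \<or> (\<exists>ys. S_walk A s f ys \<and> hd ys = x \<and> last ys = y))}"

definition num_strong_nodal_domains :: "real mat \<Rightarrow> (nat \<Rightarrow> nat \<Rightarrow> real) \<Rightarrow> (nat \<Rightarrow> real) \<Rightarrow> nat" where
  "num_strong_nodal_domains A s f = card (nonzero_set A f // strong_rel A s f)"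

definition zero_nbhd_set :: "real mat \<Rightarrow> (nat \<Rightarrow> real) \<Rightarrow> nat set" where
  "zero_nbhd_set A f = {x. x < dim_row A \<and> f x = 0 \<and> (\<forall>y. adj A x y \<longrightarrow> f y = 0)}"

end

theory Submission
  imports Defs "Jordan_Normal_Form.Spectral_Radius"
begin

text \<open>Write \<open>B\<close> for the matrix shifted by the eigenvalue, \<open>W\<close> for the support of \<open>f\<close>, \<open>Z\<close> for its
zeros, and suppose first that every zero has a neighbour in \<open>W\<close>. Substituting \<open>g = f h\<close> turns the
quadratic form of \<open>B\<close> into minus one half of the sum over \<open>i\<close>, \<open>j\<close> of
\<open>a i j * f i * f j * (h i - h j)^2\<close>, so functions \<open>h\<close> that are constant on the domains of \<open>\<Gamma>\<close>
(of \<open>-\<Gamma>\<close>) span a space on which \<open>B\<close> is negative (positive) semidefinite. Hence the two domain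
numbers are at most \<open>n\<^sub>- + n\<^sub>0\<close> and \<open>n\<^sub>+ + n\<^sub>0\<close>. Conversely their sum is at least \<open>2|W|\<close> minus the
number of edges inside \<open>W\<close>. On a forest the only circulation is zero; applied to
\<open>a i j * (f j * g i - f i * g j)\<close> for \<open>g\<close> in the kernel of \<open>B\<close>, this gives that \<open>n\<^sub>0\<close> plus the number
of edges inside \<open>W\<close> plus \<open>|Z|\<close> is at most \<open>|W|\<close>. Adding everything up forces equality throughout.
In general one deletes \<open>\<F>\<close>: the positive and negative indices drop by \<open>c\<^sub>1\<close> and \<open>c\<^sub>2\<close> by interlacing,
and kernel vectors of the deleted matrix vanish next to \<open>\<F>\<close>, so they extend by zero.\<close>

subsection \<open>Linear systems, forests and walks\<close>

text \<open>Gaussian elimination, by induction on the equations. The dimension counts below rest on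
  it: each builds a nonzero combination of more vectors than there are linear conditions.\<close>

lemma homogeneous_system_nontrivial:
  fixes c :: "'j \<Rightarrow> 'i \<Rightarrow> 'a :: field"
  assumes "finite J" "finite I" "card J < card I"
  obtains x where "\<exists>i\<in>I. x i \<noteq> 0" "\<And>j. j \<in> J \<Longrightarrow> (\<Sum>i\<in>I. c j i * x i) = 0"
proof -
  have "\<exists>x. (\<exists>i\<in>I. x i \<noteq> 0) \<and> (\<forall>j\<in>J. (\<Sum>i\<in>I. c j i * x i) = 0)"
    using assms
  proof (induction J arbitrary: I c rule: finite_induct)
    case empty
    then obtain i where "i \<in> I" by (metis card.empty card_gt_0_iff equals0I)
    then show ?case by (intro exI[of _ "\<lambda>_. 1"]) auto
  next
    case (insert k J)
    show ?case
    proof (cases "\<forall>i\<in>I. c k i = 0")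
      case True
      from insert obtain x where "\<exists>i\<in>I. x i \<noteq> 0" "\<forall>j\<in>J. (\<Sum>i\<in>I. c j i * x i) = 0"
        by (metis card_insert_disjoint Suc_lessD)
      with True show ?thesis by (intro exI[of _ x]) auto
    next
      case False
      then obtain p where p: "p \<in> I" "c k p \<noteq> 0" by auto
      let ?I = "I - {p}"
      have "card J < card ?I" "finite ?I" using insert p by auto
      then obtain x where x: "\<exists>i\<in>?I. x i \<noteq> 0"
        and eq: "\<forall>j\<in>J. (\<Sum>i\<in>?I. (c j i - c j p * c k i / c k p) * x i) = 0"
        using insert.IH[of ?I "\<lambda>j i. c j i - c j p * c k i / c k p"] by blast
      define S where "S j = (\<Sum>i\<in>?I. c j i * x i)" for j
      \<comment> \<open>Back substitution: \<open>x\<close> solves the system with the pivot unknown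
        eliminated, and the value at \<open>p\<close> is chosen so that equation \<open>k\<close>
        holds as well.\<close>
      define y where "y = x(p := - S k / c k p)"
      have y: "(\<Sum>i\<in>I. c j i * y i) = S j - c j p * S k / c k p" for j
      proof -
        have "(\<Sum>i\<in>I. c j i * y i) = c j p * y p + (\<Sum>i\<in>?I. c j i * y i)"
          using p insert.prems by (simp add: sum.remove)
        also have "(\<Sum>i\<in>?I. c j i * y i) = S j" unfolding S_def y_def by (intro sum.cong) auto
        finally show ?thesis by (simp add: y_def)
      qed
      have "(\<Sum>i\<in>I. c j i * y i) = 0" if "j \<in> J" for j
      proof -
        have "0 = (\<Sum>i\<in>?I. c j i * x i - c j p / c k p * (c k i * x i))"
          using eq that by (auto simp: algebra_simps)
        also have "\<dots> = S j - c j p / c k p * S k"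
          unfolding S_def sum_subtractf sum_distrib_left ..
        finally show ?thesis by (simp add: y)
      qed
      moreover have "(\<Sum>i\<in>I. c k i * y i) = 0" using p by (simp add: y)
      moreover have "\<exists>i\<in>I. y i \<noteq> 0" using x by (auto simp: y_def)
      ultimately show ?thesis by blast
    qed
  qed
  then show thesis using that by blast
qed

text \<open>A longest path in the support of \<open>\<phi>\<close> can be continued at its end because of the zero divergence;
the new vertex must lie on the path and closes a cycle.\<close>

lemma forest_circulation_zero:
  fixes \<phi> :: "nat \<Rightarrow> nat \<Rightarrow> real"
  assumes acyclic: "\<not> has_cycle A"
    and supp: "\<And>i j. \<phi> i j \<noteq> 0 \<Longrightarrow> adj A i j"
    and antisym: "\<And>i j. \<phi> j i = - \<phi> i j"
    and div: "\<And>i. i < dim_row A \<Longrightarrow> (\<Sum>j<dim_row A. \<phi> i j) = 0"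
  shows "\<phi> i j = 0"
proof (rule ccontr)
  assume ij: "\<phi> i j \<noteq> 0"
  define P where "P xs \<longleftrightarrow> length xs \<ge> 2 \<and> distinct xs \<and>
    (\<forall>m. Suc m < length xs \<longrightarrow> \<phi> (xs ! m) (xs ! Suc m) \<noteq> 0)" for xs
  have adjD: "i < dim_row A \<and> j < dim_row A \<and> i \<noteq> j" if "\<phi> i j \<noteq> 0" for i j
    using supp[OF that] by (auto simp: adj_def)
  have bound: "length xs \<le> dim_row A" if "P xs" for xs
  proof -
    have "xs ! m < dim_row A" if "m < length xs" for m
      using \<open>P xs\<close> that adjD[of "xs ! m" "xs ! Suc m"] adjD[of "xs ! (m - 1)" "xs ! m"]
      unfolding P_def by (cases m) (auto simp: Suc_lessI)
    then have "set xs \<subseteq> {..<dim_row A}" by (auto simp: in_set_conv_nth)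
    then have "card (set xs) \<le> dim_row A" using card_mono[of "{..<dim_row A}"] by auto
    then show ?thesis using that by (simp add: P_def distinct_card)
  qed
  have "P [i, j]" using ij adjD by (auto simp: P_def)
  then obtain xs where P: "P xs" and max: "\<And>ys. P ys \<Longrightarrow> length ys \<le> length xs"
    using bound ex_has_greatest_nat[of P "[i, j]" length "Suc (dim_row A)"]
    by (metis less_Suc_eq_le)
  then obtain v u zs where xs: "xs = v # u # zs"
    unfolding P_def by (metis One_nat_def Suc_1 Suc_le_length_iff)
  have vu: "\<phi> v u \<noteq> 0" using P unfolding P_def xs by force
  have "\<exists>w. w \<noteq> u \<and> \<phi> v w \<noteq> 0"
  proof (rule ccontr)
    assume "\<not> ?thesis"
    then have "(\<Sum>j<dim_row A. \<phi> v j) = (\<Sum>j<dim_row A. if j = u then \<phi> v u else 0)"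
      by (intro sum.cong) auto
    then show False using div[of v] adjD[OF vu] vu by simp
  qed
  then obtain w where w: "w \<noteq> u" "\<phi> v w \<noteq> 0" by blast
  have wv: "\<phi> w v \<noteq> 0" using w antisym[of v w] by simp
  show False
  proof (cases "w \<in> set xs")
    case False
    have "P (w # xs)" using P False wv unfolding P_def xs
      by (auto simp: nth_Cons split: nat.splits)
    then show False using max by fastforce
  next
    case True
    then obtain k where k: "k < length xs" "xs ! k = w" by (auto simp: in_set_conv_nth)
    \<comment> \<open>With \<open>k\<close> neither 0 nor 1, the prefix up to \<open>w\<close> has
      at least three vertices, as \<open>has_cycle\<close> demands; position 1 is excluded because
      it holds \<open>u\<close>.\<close>
    have "k \<noteq> 0" using k adjD[OF w(2)] by (cases k) (auto simp: xs)
    have "k \<noteq> 1" using k w by (auto simp: xs)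
    let ?cs = "take (Suc k) xs"
    have len: "length ?cs = Suc k" using k by simp
    have "adj A (?cs ! m) (?cs ! Suc m)" if "Suc m < length ?cs" for m
      using that P k by (auto simp: P_def intro!: supp)
    moreover have "adj A (last ?cs) (hd ?cs)"
    proof -
      have "last ?cs = w" using k len by (subst last_conv_nth) auto
      moreover have "hd ?cs = v" by (simp add: xs)
      ultimately show ?thesis using supp[OF wv] by simp
    qed
    ultimately have "has_cycle A"
      unfolding has_cycle_def using P len \<open>k \<noteq> 0\<close> \<open>k \<noteq> 1\<close>
      by (intro exI[of _ ?cs]) (auto simp: P_def)
    then show False using acyclic by blast
  qed
qed

section \<open>Strong nodal domains as classes of a reachability relation\<close>

text \<open>Closure of the one-step relation replaces lists of vertices and makes rule induction
  available. Its reflexive part absorbs the case \<open>x = y\<close>, and the sign condition keeps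
  both ends of every step in the support of \<open>f\<close>.\<close>

lemma strong_rel_conv_rtrancl:
  "strong_rel A s f = {(x, y). x \<in> nonzero_set A f \<and>
     (x, y) \<in> {(i, j). adj A i j \<and> f i * s i j * f j > 0}\<^sup>*}"
    (is "_ = {(x, y). _ \<and> (x, y) \<in> ?E\<^sup>*}")
proof -
  have walk: "(hd ys, last ys) \<in> ?E\<^sup>*" if "S_walk A s f ys" for ys
  proof -
    have "(ys ! 0, ys ! m) \<in> ?E\<^sup>*" if "m < length ys" for m
      using that
    proof (induction m)
      case (Suc m)
      then have "(ys ! m, ys ! Suc m) \<in> ?E"
        using \<open>S_walk A s f ys\<close> by (auto simp: S_walk_def is_walk_def)
      with Suc show ?case by (meson Suc_lessD rtrancl.rtrancl_into_rtrancl)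
    qed simp
    moreover have "ys \<noteq> []" using that by (auto simp: S_walk_def is_walk_def)
    ultimately show ?thesis by (simp add: hd_conv_nth last_conv_nth)
  qed
  have ex: "y \<in> nonzero_set A f \<and> (x = y \<or> (\<exists>ys. S_walk A s f ys \<and> hd ys = x \<and> last ys = y))"
    if "(x, y) \<in> ?E\<^sup>*" "x \<in> nonzero_set A f" for x y
    using that
  proof (induction rule: rtrancl_induct)
    case (step y z)
    have yz: "S_walk A s f [y, z]" and z: "z \<in> nonzero_set A f"
      using step by (auto simp: S_walk_def is_walk_def nonzero_set_def adj_def)
    from step consider "x = y" | ys where "S_walk A s f ys" "hd ys = x" "last ys = y" by blast
    then have "\<exists>ys. S_walk A s f ys \<and> hd ys = x \<and> last ys = z"
    proof cases
      case 1
      with yz show ?thesis by (intro exI[of _ "[y, z]"]) auto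
    next
      case 2
      then have ne: "ys \<noteq> []" by (auto simp: S_walk_def is_walk_def)
      have "ys ! m = y" if "Suc m = length ys" for m
        using 2 ne that by (metis diff_Suc_1 last_conv_nth)
      then have "S_walk A s f (ys @ [z])" using 2 yz
        by (auto simp: S_walk_def is_walk_def nth_append less_Suc_eq)
      with 2 ne show ?thesis by (intro exI[of _ "ys @ [z]"]) auto
    qed
    with z show ?case by blast
  qed auto
  show ?thesis using walk ex unfolding strong_rel_def by blast
qed

lemma equiv_strong_rel:
  assumes "\<And>i j. adj A i j \<Longrightarrow> adj A j i" "\<And>i j. adj A i j \<Longrightarrow> s i j = s j i"
  shows "equiv (nonzero_set A f) (strong_rel A s f)"
proof -
  let ?E = "{(i, j). adj A i j \<and> f i * s i j * f j > 0}"
  have "sym ?E"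
  proof (rule symI)
    fix i j assume "(i, j) \<in> ?E"
    then show "(j, i) \<in> ?E" using assms[of i j] by (simp add: mult_ac)
  qed
  then have sym: "sym (?E\<^sup>*)" by (rule sym_rtrancl)
  have sub: "strong_rel A s f \<subseteq> nonzero_set A f \<times> nonzero_set A f"
    by (auto simp: strong_rel_def)
  show ?thesis
  proof (rule equivI)
    show "refl_on (nonzero_set A f) (strong_rel A s f)"
      using sub by (auto simp: refl_on_def strong_rel_conv_rtrancl)
    show "sym (strong_rel A s f)"
      using sub sym unfolding strong_rel_conv_rtrancl sym_def by blast
    show "trans (strong_rel A s f)"
      unfolding strong_rel_conv_rtrancl trans_def by (auto intro: rtrancl_trans)
    show "strong_rel A s f \<subseteq> nonzero_set A f \<times> nonzero_set A f" by (rule sub)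
  qed
qed

subsection \<open>Orthogonal diagonalization of real symmetric matrices\<close>

text \<open>A complex eigenvalue \<open>z\<close> with eigenvector \<open>v\<close> exists. The
  Hermitian form of \<open>A\<close> at \<open>v\<close> equals \<open>z\<close> times the squared
  norm of \<open>v\<close> and, by symmetry, is its own conjugate; so \<open>z\<close> is real and a
  root of the real characteristic polynomial.\<close>

lemma real_symmetric_ex_eigenvalue:
  fixes A :: "real mat"
  assumes A: "A \<in> carrier_mat n n" and sym: "A\<^sup>T = A" and n: "n > 0"
  obtains e where "eigenvalue A e"
proof -
  let ?C = "map_mat complex_of_real A"
  have C: "?C \<in> carrier_mat n n" using A by simp
  obtain z where z: "eigenvalue ?C z"
    using spectrum_non_empty[OF C n] by (auto simp: spectrum_def)
  then obtain v where v: "v \<in> carrier_vec n" "v \<noteq> 0\<^sub>v n" and ev: "?C *\<^sub>v v = z \<cdot>\<^sub>v v"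
    using A by (auto simp: eigenvalue_def eigenvector_def)
  have symA: "A $$ (i, j) = A $$ (j, i)" if "i < n" "j < n" for i j
    using arg_cong[OF sym, of "\<lambda>M. M $$ (i, j)"] A that by simp
  have row: "(\<Sum>j<n. of_real (A $$ (i, j)) * v $ j) = z * v $ i" if "i < n" for i
    using arg_cong[OF ev, of "\<lambda>w. w $ i"] A v that
    by (simp add: scalar_prod_def lessThan_atLeast0)
  define N where "N = (\<Sum>i<n. (cmod (v $ i))\<^sup>2)"
  have "N > 0"
  proof -
    obtain i where "i < n" "v $ i \<noteq> 0" using v by (metis carrier_vecD eq_vecI index_zero_vec)
    then have "(cmod (v $ i))\<^sup>2 > 0" "(cmod (v $ i))\<^sup>2 \<le> N" unfolding N_def
      by (auto intro!: member_le_sum)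
    then show ?thesis by linarith
  qed
  define Q where "Q = (\<Sum>i<n. \<Sum>j<n. cnj (v $ i) * of_real (A $$ (i, j)) * v $ j)"
  have "Q = (\<Sum>i<n. cnj (v $ i) * (z * v $ i))"
    unfolding Q_def by (intro sum.cong refl) (simp add: row[symmetric] sum_distrib_left mult.assoc)
  also have "\<dots> = z * of_real N"
    unfolding N_def of_real_sum sum_distrib_left
    by (intro sum.cong refl) (simp add: complex_norm_square mult_ac del: of_real_power)
  finally have QN: "Q = z * of_real N" .
  have "cnj Q = (\<Sum>i<n. \<Sum>j<n. v $ i * of_real (A $$ (i, j)) * cnj (v $ j))"
    unfolding Q_def by simp
  also have "\<dots> = (\<Sum>j<n. \<Sum>i<n. v $ i * of_real (A $$ (i, j)) * cnj (v $ j))"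
    by (rule sum.swap)
  also have "\<dots> = Q" unfolding Q_def by (intro sum.cong refl) (simp add: symA mult_ac)
  finally have "cnj z = z" using QN \<open>N > 0\<close> by simp
  then have "z \<in> \<real>" by (simp add: Reals_cnj_iff)
  then obtain e where e: "z = of_real e" by (auto elim: Reals_cases)
  have "poly (char_poly ?C) z = 0" using z eigenvalue_root_char_poly[OF C] by simp
  then have "poly (char_poly A) e = 0"
    by (simp add: e of_real_hom.char_poly_hom[OF A])
  then have "eigenvalue A e" using eigenvalue_root_char_poly[OF A] by simp
  then show thesis by (rule that)
qed

text \<open>For \<open>u = 0\<close> the value \<open>2 / 0 = 0\<close> makes this the identity matrix, so no case distinction is needed below.\<close>

definition householder :: "nat \<Rightarrow> real vec \<Rightarrow> real mat" where
  "householder n u = mat n n (\<lambda>(i, j). (if i = j then 1 else 0) - 2 / (u \<bullet> u) * (u $ i) * (u $ j))"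

lemma householder_carrier [simp]: "householder n u \<in> carrier_mat n n"
  by (simp add: householder_def)

lemma householder_transpose: "(householder n u)\<^sup>T = householder n u"
  by (rule eq_matI) (auto simp: householder_def)

lemma householder_involution:
  assumes u: "u \<in> carrier_vec n"
  shows "householder n u * householder n u = 1\<^sub>m n"
proof (rule eq_matI)
  fix i j assume "i < dim_row (1\<^sub>m n)" "j < dim_col (1\<^sub>m n)"
  then have i: "i < n" and j: "j < n" by auto
  define c where "c = 2 / (u \<bullet> u)"
  define s where "s = (\<Sum>k<n. u $ k * u $ k)"
  have us: "u \<bullet> u = s" using u by (auto simp: scalar_prod_def s_def lessThan_atLeast0)
  have cs: "c * c * s = 2 * c" unfolding c_def us by (simp add: field_simps)
  have "(householder n u * householder n u) $$ (i, j) =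
      (\<Sum>k<n. ((if i = k then 1 else 0) - c * u $ i * u $ k) * ((if k = j then 1 else 0) - c * u $ k * u $ j))"
    using i j by (simp add: householder_def scalar_prod_def lessThan_atLeast0 c_def)
  also have "\<dots> = (\<Sum>k<n. (if k = i then (if i = j then 1 else 0) else 0)
      - (if k = i then c * u $ i * u $ j else 0) - (if k = j then c * u $ i * u $ j else 0)
      + c * c * u $ i * u $ j * (u $ k * u $ k))"
    by (intro sum.cong) (auto simp: algebra_simps)
  also have "\<dots> = (if i = j then 1 else 0) - 2 * c * u $ i * u $ j + c * c * u $ i * u $ j * s"
    using i j unfolding s_def by (simp add: sum.distrib sum_subtractf sum_distrib_left)
  also have "\<dots> = (if i = j then 1 else 0) + (c * c * s - 2 * c) * (u $ i * u $ j)"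
    by (simp add: algebra_simps)
  finally show "(householder n u * householder n u) $$ (i, j) = 1\<^sub>m n $$ (i, j)"
    using i j cs by simp
qed (auto simp: householder_def)

text \<open>The reflection along \<open>u = v - unit_vec n 0\<close> exchanges these two unit
  vectors; the computation rests on \<open>u \<bullet> u = - 2 * u $ 0\<close>. If \<open>v\<close>
  is already the first unit vector, then \<open>u = 0\<close> and the reflection is the
  identity.\<close>

lemma ex_reflection_first_column:
  fixes v :: "real vec"
  assumes v: "v \<in> carrier_vec n" and unit: "v \<bullet> v = 1" and n: "n > 0"
  obtains H where "H \<in> carrier_mat n n" "H\<^sup>T = H" "H * H = 1\<^sub>m n" "col H 0 = v"
proof
  define u where "u = v - unit_vec n 0"
  have u: "u \<in> carrier_vec n" using v by (simp add: u_def)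
  have u_nth: "u $ i = v $ i - (if i = 0 then 1 else 0)" if "i < n" for i
    using that v n by (simp add: u_def)
  have uu: "u \<bullet> u = - 2 * u $ 0"
  proof -
    have "u \<bullet> u = (\<Sum>i<n. v $ i * v $ i - (if i = 0 then 2 * v $ 0 else 0) + (if i = 0 then 1 else 0))"
      using u by (auto simp: scalar_prod_def lessThan_atLeast0 u_nth algebra_simps intro!: sum.cong)
    also have "\<dots> = v \<bullet> v - 2 * v $ 0 + 1"
      using v n by (simp add: sum.distrib sum_subtractf scalar_prod_def lessThan_atLeast0)
    finally show ?thesis using unit u_nth[of 0] n by simp
  qed
  let ?H = "householder n u"
  show "?H \<in> carrier_mat n n" "?H\<^sup>T = ?H" by (auto simp: householder_transpose)
  show "?H * ?H = 1\<^sub>m n" by (rule householder_involution[OF u])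
  show "col ?H 0 = v"
  proof (rule eq_vecI)
    fix i assume "i < dim_vec v"
    then have i: "i < n" using v by simp
    have "2 / (u \<bullet> u) * (u $ i) * (u $ 0) = - u $ i"
    proof (cases "u $ 0 = 0")
      case True
      then have "u \<bullet> u = 0" using uu by simp
      then have "(\<Sum>i<n. u $ i * u $ i) = 0" using u by (auto simp: scalar_prod_def lessThan_atLeast0)
      then have "u $ i * u $ i = 0" using i by (subst (asm) sum_nonneg_eq_0_iff) auto
      then show ?thesis by simp
    qed (simp add: uu)
    then show "col ?H 0 $ i = v $ i" using i n u_nth[of i] by (simp add: householder_def)
  qed (use v in \<open>simp add: householder_def\<close>)
qed

text \<open>Induction on the size: conjugation by a reflection that sends the first unit vector to a
  unit eigenvector splits off a 1 by 1 block, and the remaining block \<open>A3\<close> is symmetric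
  again.\<close>

lemma real_symmetric_diagonalization:
  fixes A :: "real mat"
  assumes "A \<in> carrier_mat n n" "A\<^sup>T = A"
  shows "\<exists>Q D. Q \<in> carrier_mat n n \<and> D \<in> carrier_mat n n \<and> Q\<^sup>T * Q = 1\<^sub>m n \<and>
    A * Q = Q * D \<and> diagonal_mat D"
  using assms
proof (induction n arbitrary: A)
  case 0
  then show ?case by (intro exI[of _ "1\<^sub>m 0"] exI[of _ A]) (auto simp: diagonal_mat_def)
next
  case (Suc n A)
  note A = Suc.prems(1) and sym = Suc.prems(2)
  obtain e where "eigenvalue A e" using real_symmetric_ex_eigenvalue[OF A sym] by blast
  then obtain w where w: "w \<in> carrier_vec (Suc n)" "w \<noteq> 0\<^sub>v (Suc n)" and Aw: "A *\<^sub>v w = e \<cdot>\<^sub>v w"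
    using A by (auto simp: eigenvalue_def eigenvector_def)
  have ww: "w \<bullet> w > 0"
  proof -
    obtain i where "i < Suc n" "w $ i \<noteq> 0" using w by (metis carrier_vecD eq_vecI index_zero_vec)
    moreover have "w \<bullet> w = (\<Sum>i<Suc n. w $ i * w $ i)" using w by (auto simp: scalar_prod_def lessThan_atLeast0)
    ultimately show ?thesis by (auto intro!: sum_pos2[of _ i] simp: zero_less_mult_iff linorder_neq_iff simp del: sum.lessThan_Suc)
  qed
  define v where "v = (1 / sqrt (w \<bullet> w)) \<cdot>\<^sub>v w"
  have v: "v \<in> carrier_vec (Suc n)" using w by (simp add: v_def)
  have vv: "v \<bullet> v = 1" using ww w by (simp add: v_def)
  have Av: "A *\<^sub>v v = e \<cdot>\<^sub>v v"
    unfolding v_def using mult_mat_vec[OF A w(1)] Aw by (simp add: smult_smult_assoc mult.commute)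
  obtain H where H: "H \<in> carrier_mat (Suc n) (Suc n)" and HT: "H\<^sup>T = H"
    and HH: "H * H = 1\<^sub>m (Suc n)" and H0: "col H 0 = v"
    using ex_reflection_first_column[OF v vv] by blast
  define B where "B = H * A * H"
  have B: "B \<in> carrier_mat (Suc n) (Suc n)" using A H by (simp add: B_def)
  have BT: "B\<^sup>T = B"
    using A H by (simp add: B_def transpose_mult[of _ "Suc n" "Suc n" _ "Suc n"] HT sym assoc_mult_mat[of _ "Suc n" "Suc n" _ "Suc n" _ "Suc n"])
  \<comment> \<open>Column 0 of \<open>H\<close> is \<open>v\<close> and \<open>H\<close> is an
    involution, so \<open>B\<close> maps the first unit vector to \<open>e\<close> times itself.
    Symmetry then clears row 0 as well.\<close>
  have "col B 0 = (H * A) *\<^sub>v v" unfolding B_def using A H H0 by (subst col_mult2[of _ "Suc n" "Suc n" _ "Suc n"]) auto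
  also have "\<dots> = e \<cdot>\<^sub>v (H *\<^sub>v v)"
    using A H v by (simp add: assoc_mult_mat_vec[of _ "Suc n" "Suc n" _ "Suc n"] Av mult_mat_vec)
  also have "H *\<^sub>v v = col (H * H) 0" unfolding H0[symmetric] using H by (subst col_mult2[of _ "Suc n" "Suc n" _ "Suc n"]) auto
  also have "\<dots> = unit_vec (Suc n) 0" by (simp add: HH)
  finally have colB: "col B 0 = e \<cdot>\<^sub>v unit_vec (Suc n) 0" .
  have col0: "B $$ (i, 0) = (if i = 0 then e else 0)" if "i < Suc n" for i
    using arg_cong[OF colB, of "\<lambda>v. v $ i"] B that by simp
  have row0: "B $$ (0, i) = (if i = 0 then e else 0)" if "i < Suc n" for i
    using arg_cong[OF BT, of "\<lambda>M. M $$ (i, 0)"] B that col0 by simp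
  define A3 where "A3 = mat n n (\<lambda>(i, j). B $$ (Suc i, Suc j))"
  have A3: "A3 \<in> carrier_mat n n" by (simp add: A3_def)
  have "B $$ (Suc i, Suc j) = B $$ (Suc j, Suc i)" if "i < n" "j < n" for i j
    using arg_cong[OF BT, of "\<lambda>M. M $$ (Suc i, Suc j)"] B that by simp
  then have "A3\<^sup>T = A3" by (intro eq_matI) (auto simp: A3_def)
  from Suc.IH[OF A3 this] obtain Q3 D3 where Q3: "Q3 \<in> carrier_mat n n" and D3: "D3 \<in> carrier_mat n n"
    and QQ3: "Q3\<^sup>T * Q3 = 1\<^sub>m n" and AQ3: "A3 * Q3 = Q3 * D3" and diag3: "diagonal_mat D3" by blast
  define E where "E = mat 1 1 (\<lambda>_. e)"
  have E: "E \<in> carrier_mat 1 1" by (simp add: E_def)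
  let ?blk = "\<lambda>X Y. four_block_mat X (0\<^sub>m 1 n) (0\<^sub>m n 1) Y"
  have Bblk: "B = ?blk E A3"
    using B by (intro eq_matI) (auto simp: E_def A3_def row0 col0)
  define Q where "Q = ?blk (1\<^sub>m 1) Q3"
  define D where "D = ?blk E D3"
  have Q: "Q \<in> carrier_mat (Suc n) (Suc n)" and D: "D \<in> carrier_mat (Suc n) (Suc n)"
    using Q3 D3 E four_block_carrier_mat[of _ 1 1 _ n n] by (auto simp: Q_def D_def)
  have QT: "Q\<^sup>T = ?blk (1\<^sub>m 1) (Q3\<^sup>T)" using Q3 unfolding Q_def
    by (subst transpose_four_block_mat[of _ 1 1 _ n _ n]) auto
  have one: "?blk (1\<^sub>m 1) (1\<^sub>m n) = 1\<^sub>m (Suc n)" by (intro eq_matI) auto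
  have QQ: "Q\<^sup>T * Q = 1\<^sub>m (Suc n)"
    unfolding QT unfolding Q_def using Q3
    by (subst mult_four_block_mat[of _ 1 1 _ n _ n _ _ 1 _ n]) (auto simp: QQ3 one)
  have BQ: "B * Q = Q * D"
  proof -
    have "B * Q = ?blk E (A3 * Q3)" unfolding Bblk Q_def using Q3 A3 E
      by (subst mult_four_block_mat[of _ 1 1 _ n _ n _ _ 1 _ n]) auto
    moreover have "Q * D = ?blk E (Q3 * D3)" unfolding D_def Q_def using Q3 D3 E
      by (subst mult_four_block_mat[of _ 1 1 _ n _ n _ _ 1 _ n]) auto
    ultimately show ?thesis by (simp add: AQ3)
  qed
  have "diagonal_mat D" using diag3 D3 E unfolding D_def diagonal_mat_def by auto
  moreover have "(H * Q)\<^sup>T * (H * Q) = 1\<^sub>m (Suc n)"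
  proof -
    have "(H * Q)\<^sup>T * (H * Q) = Q\<^sup>T * (H * H) * Q"
      using H Q by (simp add: transpose_mult[of _ "Suc n" "Suc n" _ "Suc n"] HT assoc_mult_mat[of _ "Suc n" "Suc n" _ "Suc n" _ "Suc n"])
    then show ?thesis using Q QQ by (simp add: HH)
  qed
  moreover have "A * (H * Q) = H * Q * D"
  proof -
    have "H * B = (H * H) * (A * H)"
      using A H by (simp add: B_def assoc_mult_mat[of _ "Suc n" "Suc n" _ "Suc n" _ "Suc n"])
    then have "A * H = H * B" using A H by (simp add: HH)
    then have "A * (H * Q) = H * (B * Q)"
      using A B H Q assoc_mult_mat[of _ "Suc n" "Suc n" _ "Suc n" _ "Suc n"] by metis
    then show ?thesis using BQ H Q D by (simp add: assoc_mult_mat[of _ "Suc n" "Suc n" _ "Suc n" _ "Suc n"])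
  qed
  ultimately show ?case using H Q D by (intro exI[of _ "H * Q"] exI[of _ D]) auto
qed

subsection \<open>Eigenbases and interlacing\<close>

lemma sum_lincomb_swap:
  fixes x :: "'a \<Rightarrow> 'c :: comm_ring"
  shows "(\<Sum>i\<in>V. (\<Sum>q\<in>K. x q * u q i) * w i) = (\<Sum>q\<in>K. x q * (\<Sum>i\<in>V. u q i * w i))"
  unfolding sum_distrib_left sum_distrib_right mult.assoc by (rule sum.swap)

text \<open>The outcome of the spectral theorem, stated for functions on a finite vertex set so that
  a principal submatrix is the same \<open>a\<close> on a smaller \<open>V\<close>. The last two
  assumptions are the two halves of orthogonality of the matrix of eigenvectors.\<close>

locale symmetric_eigenbasis =
  fixes V :: "'v set" and a :: "'v \<Rightarrow> 'v \<Rightarrow> real"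
    and I :: "'i set" and v :: "'i \<Rightarrow> 'v \<Rightarrow> real" and \<mu> :: "'i \<Rightarrow> real"
  assumes finite_V: "finite V" and finite_I: "finite I"
    and sym: "i \<in> V \<Longrightarrow> j \<in> V \<Longrightarrow> a i j = a j i"
    and eigen: "p \<in> I \<Longrightarrow> i \<in> V \<Longrightarrow> (\<Sum>j\<in>V. a i j * v p j) = \<mu> p * v p i"
    and orthonormal: "p \<in> I \<Longrightarrow> q \<in> I \<Longrightarrow> (\<Sum>i\<in>V. v p i * v q i) = of_bool (p = q)"
    and complete: "i \<in> V \<Longrightarrow> j \<in> V \<Longrightarrow> (\<Sum>p\<in>I. v p i * v p j) = of_bool (i = j)"
begin

definition ip :: "('v \<Rightarrow> real) \<Rightarrow> 'i \<Rightarrow> real" where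
  "ip g p = (\<Sum>i\<in>V. g i * v p i)"

text \<open>Both cardinalities equal the sum of all squares of the entries \<open>v p i\<close>,
  summed in either order.\<close>

lemma card_eq: "card I = card V"
proof -
  have "real (card I) = (\<Sum>p\<in>I. \<Sum>i\<in>V. v p i * v p i)" by (simp add: orthonormal)
  also have "\<dots> = (\<Sum>i\<in>V. \<Sum>p\<in>I. v p i * v p i)" by (rule sum.swap)
  also have "\<dots> = real (card V)" by (simp add: complete)
  finally show ?thesis by simp
qed

lemma card_trichotomy:
  "card {p \<in> I. \<mu> p < l} + card {p \<in> I. \<mu> p = l} + card {p \<in> I. \<mu> p > l} = card V"
proof -
  have "I = {p \<in> I. \<mu> p < l} \<union> {p \<in> I. \<mu> p = l} \<union> {p \<in> I. \<mu> p > l}" by auto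
  then have "card I = card ({p \<in> I. \<mu> p < l} \<union> {p \<in> I. \<mu> p = l} \<union> {p \<in> I. \<mu> p > l})" by simp
  also have "\<dots> = card {p \<in> I. \<mu> p < l} + card {p \<in> I. \<mu> p = l} + card {p \<in> I. \<mu> p > l}"
    using finite_I by (subst card_Un_disjoint; (subst card_Un_disjoint)?) auto
  finally show ?thesis by (simp add: card_eq)
qed

lemma card_le_conv:
  "card {p \<in> I. \<mu> p \<le> l} = card {p \<in> I. \<mu> p < l} + card {p \<in> I. \<mu> p = l}"
proof -
  have "{p \<in> I. \<mu> p \<le> l} = {p \<in> I. \<mu> p < l} \<union> {p \<in> I. \<mu> p = l}" by auto
  then show ?thesis using finite_I by (simp add: card_Un_disjoint disjoint_iff)
qed

section \<open>Coordinates with respect to the eigenbasis\<close>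

lemma parseval: "(\<Sum>p\<in>I. ip g p * ip h p) = (\<Sum>i\<in>V. g i * h i)"
proof -
  have "(\<Sum>p\<in>I. ip g p * ip h p) = (\<Sum>p\<in>I. \<Sum>i\<in>V. \<Sum>j\<in>V. g i * h j * (v p i * v p j))"
    by (simp add: ip_def sum_product mult_ac)
  also have "\<dots> = (\<Sum>i\<in>V. \<Sum>p\<in>I. \<Sum>j\<in>V. g i * h j * (v p i * v p j))"
    by (rule sum.swap)
  also have "\<dots> = (\<Sum>i\<in>V. \<Sum>j\<in>V. \<Sum>p\<in>I. g i * h j * (v p i * v p j))"
    by (intro sum.cong refl sum.swap)
  also have "\<dots> = (\<Sum>i\<in>V. \<Sum>j\<in>V. if i = j then g i * h j else 0)"
    by (intro sum.cong refl) (simp add: sum_distrib_left[symmetric] complete)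
  also have "\<dots> = (\<Sum>i\<in>V. g i * h i)" by (simp add: finite_V)
  finally show ?thesis .
qed

lemma ip_cong: "(\<And>i. i \<in> V \<Longrightarrow> g i = h i) \<Longrightarrow> ip g p = ip h p"
  by (simp add: ip_def)

lemma ip_apply:
  assumes "p \<in> I"
  shows "ip (\<lambda>i. \<Sum>j\<in>V. a i j * g j) p = \<mu> p * ip g p"
proof -
  have "ip (\<lambda>i. \<Sum>j\<in>V. a i j * g j) p = (\<Sum>i\<in>V. \<Sum>j\<in>V. g j * (a j i * v p i))"
    unfolding ip_def sum_distrib_right by (intro sum.cong refl) (simp add: sym mult_ac)
  also have "\<dots> = (\<Sum>j\<in>V. \<Sum>i\<in>V. g j * (a j i * v p i))" by (rule sum.swap)
  also have "\<dots> = (\<Sum>j\<in>V. g j * (\<mu> p * v p j))"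
    by (simp add: sum_distrib_left[symmetric] eigen assms)
  finally show ?thesis by (simp add: ip_def sum_distrib_left mult_ac)
qed

text \<open>In these coordinates the shifted form is diagonal, so its sign can be read off from
  which coordinates vanish.\<close>

lemma quadratic_form:
  "(\<Sum>i\<in>V. g i * (\<Sum>j\<in>V. a i j * g j)) - l * (\<Sum>i\<in>V. g i * g i) = (\<Sum>p\<in>I. (\<mu> p - l) * (ip g p)\<^sup>2)"
proof -
  have "(\<Sum>i\<in>V. g i * (\<Sum>j\<in>V. a i j * g j)) = (\<Sum>p\<in>I. ip g p * ip (\<lambda>i. \<Sum>j\<in>V. a i j * g j) p)"
    by (rule parseval[symmetric])
  also have "\<dots> = (\<Sum>p\<in>I. ip g p * (\<mu> p * ip g p))"
    by (intro sum.cong refl) (simp add: ip_apply)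
  finally have "(\<Sum>i\<in>V. g i * (\<Sum>j\<in>V. a i j * g j)) = (\<Sum>p\<in>I. ip g p * (\<mu> p * ip g p))" .
  moreover have "(\<Sum>i\<in>V. g i * g i) = (\<Sum>p\<in>I. ip g p * ip g p)" by (rule parseval[symmetric])
  ultimately show ?thesis
    by (simp add: sum_distrib_left sum_subtractf[symmetric] power2_eq_square algebra_simps)
qed

lemma ex_ip_nonzero:
  assumes "i \<in> V" "g i \<noteq> 0"
  obtains p where "p \<in> I" "ip g p \<noteq> 0"
proof -
  have "0 < (\<Sum>i\<in>V. g i * g i)"
    using assms finite_V by (intro sum_pos2[of _ i]) (auto simp: zero_less_mult_iff linorder_neq_iff)
  then have "(\<Sum>p\<in>I. ip g p * ip g p) \<noteq> 0" by (simp add: parseval)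
  moreover have "(\<Sum>p\<in>I. ip g p * ip g p) = 0" if "\<forall>p\<in>I. ip g p = 0"
    using that by simp
  ultimately show thesis using that by blast
qed

lemma ip_lincomb:
  assumes "K \<subseteq> I" "p \<in> K"
  shows "ip (\<lambda>i. \<Sum>q\<in>K. x q * v q i) p = x p"
proof -
  have "ip (\<lambda>i. \<Sum>q\<in>K. x q * v q i) p = (\<Sum>q\<in>K. x q * (\<Sum>i\<in>V. v q i * v p i))"
    unfolding ip_def by (rule sum_lincomb_swap)
  also have "\<dots> = (\<Sum>q\<in>K. if q = p then x q else 0)"
    using assms by (intro sum.cong refl) (auto simp: orthonormal subset_iff)
  also have "\<dots> = x p" using assms finite_I by (simp add: finite_subset)
  finally show ?thesis .
qed

lemma ip_lincomb_outside:
  assumes "K \<subseteq> I" "p \<in> I" "p \<notin> K"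
  shows "ip (\<lambda>i. \<Sum>q\<in>K. x q * v q i) p = 0"
proof -
  have "ip (\<lambda>i. \<Sum>q\<in>K. x q * v q i) p = (\<Sum>q\<in>K. x q * (\<Sum>i\<in>V. v q i * v p i))"
    unfolding ip_def by (rule sum_lincomb_swap)
  also have "\<dots> = 0"
    using assms by (intro sum.neutral ballI) (auto simp: orthonormal subset_iff)
  finally show ?thesis .
qed

lemma lincomb_nonzero:
  assumes "K \<subseteq> I" "p \<in> K" "x p \<noteq> 0"
  obtains i where "i \<in> V" "(\<Sum>q\<in>K. x q * v q i) \<noteq> 0"
proof (rule ccontr)
  assume "\<not> thesis"
  with that have "\<forall>i\<in>V. (\<Sum>q\<in>K. x q * v q i) = 0" by blast
  then have "ip (\<lambda>i. \<Sum>q\<in>K. x q * v q i) p = 0" unfolding ip_def by simp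
  then show False using ip_lincomb[OF assms(1,2), of x] assms(3) by simp
qed

text \<open>The eigenvectors stay, while eigenvalues below and above a threshold change places; each
  one-sided result thus yields its mirror image.\<close>

lemma negate: "symmetric_eigenbasis V (\<lambda>i j. - a i j) I v (\<lambda>p. - \<mu> p)"
  by unfold_locales
    (auto simp: finite_V finite_I sym eigen orthonormal complete sum_negf)

section \<open>Comparison with principal submatrices\<close>

text \<open>Otherwise some nonzero combination of the eigenvectors on \<open>V'\<close> above
  \<open>l\<close>, extended by zero, would be orthogonal to all eigenvectors on \<open>V\<close>
  above \<open>l\<close>. Extension by zero preserves the shifted form, which would be positive in
  one basis and nonpositive in the other.\<close>

lemma interlacing_above:
  assumes "symmetric_eigenbasis V' a I' v' \<mu>'" and sub: "V' \<subseteq> V"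
  shows "card {p \<in> I'. \<mu>' p > l} \<le> card {p \<in> I. \<mu> p > l}"
proof (rule ccontr)
  assume less: "\<not> ?thesis"
  interpret B: symmetric_eigenbasis V' a I' v' \<mu>' by fact
  let ?K = "{p \<in> I'. \<mu>' p > l}"
  define u where "u q i = (if i \<in> V' then v' q i else 0)" for q i
  obtain x where x0: "\<exists>q\<in>?K. x q \<noteq> 0"
    and x: "\<And>p. p \<in> {p \<in> I. \<mu> p > l} \<Longrightarrow> (\<Sum>q\<in>?K. ip (u q) p * x q) = 0"
    using homogeneous_system_nontrivial[of "{p \<in> I. \<mu> p > l}" ?K "\<lambda>p q. ip (u q) p"]
      finite_I B.finite_I less by auto
  define g' where "g' i = (\<Sum>q\<in>?K. x q * v' q i)" for i
  define g where "g i = (if i \<in> V' then g' i else 0)" for i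
  have gu: "g i = (\<Sum>q\<in>?K. x q * u q i)" for i by (simp add: g_def g'_def u_def)
  have ipg: "ip g p = 0" if "p \<in> I" "\<mu> p > l" for p
  proof -
    have "ip g p = (\<Sum>q\<in>?K. x q * ip (u q) p)"
      unfolding ip_def gu by (rule sum_lincomb_swap)
    then show ?thesis using x[of p] that by (simp add: mult.commute)
  qed
  have sums: "(\<Sum>i\<in>V. g i * h i) = (\<Sum>i\<in>V'. g' i * h i)" for h
    using finite_V sub by (intro sum.mono_neutral_cong_right) (auto simp: g_def)
  have sums': "(\<Sum>j\<in>V. a i j * g j) = (\<Sum>j\<in>V'. a i j * g' j)" for i
    using sums[of "a i"] by (simp add: mult.commute)
  have gg: "(\<Sum>i\<in>V'. g' i * g i) = (\<Sum>i\<in>V'. g' i * g' i)" by (simp add: g_def)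
  have "(\<Sum>p\<in>I. (\<mu> p - l) * (ip g p)\<^sup>2) = (\<Sum>p\<in>I'. (\<mu>' p - l) * (B.ip g' p)\<^sup>2)"
    unfolding quadratic_form[symmetric] B.quadratic_form[symmetric] sums sums' gg ..
  moreover have "(\<Sum>p\<in>I. (\<mu> p - l) * (ip g p)\<^sup>2) \<le> 0"
  proof (rule sum_nonpos)
    fix p assume "p \<in> I"
    then show "(\<mu> p - l) * (ip g p)\<^sup>2 \<le> 0"
      using ipg by (cases "\<mu> p > l") (auto intro: mult_nonpos_nonneg)
  qed
  moreover have "(\<Sum>p\<in>I'. (\<mu>' p - l) * (B.ip g' p)\<^sup>2) > 0"
  proof -
    obtain q where q: "q \<in> ?K" "x q \<noteq> 0" using x0 by blast
    have ip': "B.ip g' p = (if p \<in> ?K then x p else 0)" if "p \<in> I'" for p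
      unfolding g'_def using that B.ip_lincomb[of ?K p x] B.ip_lincomb_outside[of ?K p x] by auto
    show ?thesis using q by (intro sum_pos2[of _ q]) (auto simp: ip' B.finite_I)
  qed
  ultimately show False by linarith
qed

lemma interlacing_below:
  assumes "symmetric_eigenbasis V' a I' v' \<mu>'" and "V' \<subseteq> V"
  shows "card {p \<in> I'. \<mu>' p < l} \<le> card {p \<in> I. \<mu> p < l}"
  using symmetric_eigenbasis.interlacing_above[OF negate symmetric_eigenbasis.negate[OF assms(1)] assms(2), of "- l"]
  by simp

text \<open>By \<open>ext\<close>, extension by zero turns eigenvectors for \<open>l\<close> on
  \<open>V'\<close> into eigenvectors for \<open>l\<close> on \<open>V\<close>. If the inequality
  failed, a nonzero one would be orthogonal to all \<open>v p\<close> with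
  \<open>\<mu> p = l\<close>; its other coordinates vanish because \<open>\<mu> p\<close> differs
  from \<open>l\<close> there.\<close>

lemma card_eigenvalue_le_of_extension:
  assumes "symmetric_eigenbasis V' a I' v' \<mu>'" and sub: "V' \<subseteq> V"
    and ext: "\<And>g i. \<lbrakk>\<And>i. i \<in> V' \<Longrightarrow> (\<Sum>j\<in>V'. a i j * g j) = l * g i; i \<in> V - V'\<rbrakk>
       \<Longrightarrow> (\<Sum>j\<in>V'. a i j * g j) = 0"
  shows "card {p \<in> I'. \<mu>' p = l} \<le> card {p \<in> I. \<mu> p = l}"
proof (rule ccontr)
  assume less: "\<not> ?thesis"
  interpret B: symmetric_eigenbasis V' a I' v' \<mu>' by fact
  let ?K = "{p \<in> I'. \<mu>' p = l}"
  define u where "u q i = (if i \<in> V' then v' q i else 0)" for q i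
  obtain x where x0: "\<exists>q\<in>?K. x q \<noteq> 0"
    and x: "\<And>p. p \<in> {p \<in> I. \<mu> p = l} \<Longrightarrow> (\<Sum>q\<in>?K. ip (u q) p * x q) = 0"
    using homogeneous_system_nontrivial[of "{p \<in> I. \<mu> p = l}" ?K "\<lambda>p q. ip (u q) p"]
      finite_I B.finite_I less by auto
  define g' where "g' i = (\<Sum>q\<in>?K. x q * v' q i)" for i
  define g where "g i = (if i \<in> V' then g' i else 0)" for i
  have gu: "g i = (\<Sum>q\<in>?K. x q * u q i)" for i by (simp add: g_def g'_def u_def)
  have ipg: "ip g p = 0" if "p \<in> I" "\<mu> p = l" for p
  proof -
    have "ip g p = (\<Sum>q\<in>?K. x q * ip (u q) p)"
      unfolding ip_def gu by (rule sum_lincomb_swap)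
    then show ?thesis using x[of p] that by (simp add: mult.commute)
  qed
  have sums: "(\<Sum>j\<in>V. a i j * g j) = (\<Sum>j\<in>V'. a i j * g' j)" for i
    using finite_V sub by (intro sum.mono_neutral_cong_right) (auto simp: g_def)
  have eig': "(\<Sum>j\<in>V'. a i j * g' j) = l * g' i" if "i \<in> V'" for i
  proof -
    have "(\<Sum>j\<in>V'. a i j * g' j) = (\<Sum>j\<in>V'. \<Sum>q\<in>?K. x q * (a i j * v' q j))"
      by (simp add: g'_def sum_distrib_left mult_ac)
    also have "\<dots> = (\<Sum>q\<in>?K. \<Sum>j\<in>V'. x q * (a i j * v' q j))" by (rule sum.swap)
    also have "\<dots> = (\<Sum>q\<in>?K. x q * (l * v' q i))"
      using that by (simp add: sum_distrib_left[symmetric] B.eigen)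
    finally show ?thesis by (simp add: g'_def sum_distrib_left mult_ac)
  qed
  have eig: "(\<Sum>j\<in>V. a i j * g j) = l * g i" if "i \<in> V" for i
    using eig' ext[OF eig'] that unfolding sums by (cases "i \<in> V'") (auto simp: g_def)
  have "ip g p = 0" if p: "p \<in> I" for p
  proof -
    have "\<mu> p * ip g p = ip (\<lambda>i. l * g i) p"
      unfolding ip_apply[OF p, symmetric] by (rule ip_cong) (rule eig)
    also have "\<dots> = l * ip g p" by (simp add: ip_def sum_distrib_left mult_ac)
    finally show ?thesis using ipg p by auto
  qed
  moreover obtain i where "i \<in> V'" "g' i \<noteq> 0"
  proof -
    obtain q where "q \<in> ?K" "x q \<noteq> 0" using x0 by blast
    then show thesis using B.lincomb_nonzero[of ?K q x] that unfolding g'_def by auto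
  qed
  then have "i \<in> V" "g i \<noteq> 0" using sub by (auto simp: g_def)
  then obtain p where "p \<in> I" "ip g p \<noteq> 0" by (rule ex_ip_nonzero)
  ultimately show False by blast
qed

end

text \<open>A submatrix is indexed from 0, whereas interlacing compares subsets of one vertex set;
  the bijection carries the eigenbasis over.\<close>

lemma symmetric_eigenbasis_reindex:
  assumes "symmetric_eigenbasis U (\<lambda>i j. a (\<pi> i) (\<pi> j)) I v \<mu>" and bij: "bij_betw \<pi> U V"
  shows "symmetric_eigenbasis V a I (\<lambda>p x. v p (the_inv_into U \<pi> x)) \<mu>"
proof -
  interpret B: symmetric_eigenbasis U "\<lambda>i j. a (\<pi> i) (\<pi> j)" I v \<mu> by fact
  have inj: "inj_on \<pi> U" and V: "V = \<pi> ` U" using bij by (auto simp: bij_betw_def)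
  have [simp]: "the_inv_into U \<pi> (\<pi> i) = i" if "i \<in> U" for i
    using inj that by (rule the_inv_into_f_f)
  have sum: "(\<Sum>x\<in>V. h x) = (\<Sum>i\<in>U. h (\<pi> i))" for h :: "_ \<Rightarrow> real"
    by (simp add: V sum.reindex[OF inj])
  show ?thesis
  proof
    show "finite V" "finite I" by (auto simp: V B.finite_V B.finite_I)
  next
    fix i j assume "i \<in> V" "j \<in> V" then show "a i j = a j i" by (auto simp: V B.sym)
  next
    fix p i assume "p \<in> I" "i \<in> V"
    then obtain k where "i = \<pi> k" "k \<in> U" by (auto simp: V)
    with \<open>p \<in> I\<close> show "(\<Sum>j\<in>V. a i j * v p (the_inv_into U \<pi> j)) = \<mu> p * v p (the_inv_into U \<pi> i)"
      by (simp add: sum B.eigen)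
  next
    fix p q assume "p \<in> I" "q \<in> I"
    then show "(\<Sum>i\<in>V. v p (the_inv_into U \<pi> i) * v q (the_inv_into U \<pi> i)) = of_bool (p = q)"
      by (simp add: sum B.orthonormal)
  next
    fix i j assume "i \<in> V" "j \<in> V"
    then show "(\<Sum>p\<in>I. v p (the_inv_into U \<pi> i) * v p (the_inv_into U \<pi> j)) = of_bool (i = j)"
      using inj by (auto simp: V B.complete inj_on_eq_iff)
  qed
qed

subsection \<open>Nodal domains and inertia\<close>

text \<open>The linear order on the vertices serves to orient edges, so that each can be counted
  once.\<close>

locale symmetric_eigenfunction = symmetric_eigenbasis V a I v \<mu>
  for V :: "'v :: linorder set" and a I and v :: "'i \<Rightarrow> 'v \<Rightarrow> real" and \<mu> +
  fixes f :: "'v \<Rightarrow> real" and l :: real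
  assumes eigenfunction: "i \<in> V \<Longrightarrow> (\<Sum>j\<in>V. a i j * f j) = l * f i"
begin

abbreviation W :: "'v set" where "W \<equiv> {i \<in> V. f i \<noteq> 0}"

lemma finite_W: "finite W" using finite_V by simp

lemma eigenfunction_negate:
  "symmetric_eigenfunction V (\<lambda>i j. - a i j) I v (\<lambda>p. - \<mu> p) f (- l)"
proof -
  interpret N: symmetric_eigenbasis V "\<lambda>i j. - a i j" I v "\<lambda>p. - \<mu> p" by (rule negate)
  show ?thesis by unfold_locales (simp add: sum_negf eigenfunction)
qed

text \<open>When the square is expanded, the terms with \<open>(h i)\<^sup>2\<close> sum to
  \<open>T\<close>, which the eigenvalue equation of \<open>f\<close> turns into \<open>l\<close>
  times the squared norm of \<open>f h\<close>. Symmetry of \<open>a\<close> gives the same for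
  \<open>(h j)\<^sup>2\<close>, and the mixed terms \<open>M\<close> are the unshifted form.\<close>

lemma edge_form:
  "(\<Sum>i\<in>V. f i * h i * (\<Sum>j\<in>V. a i j * (f j * h j))) - l * (\<Sum>i\<in>V. f i * h i * (f i * h i)) =
    - (\<Sum>i\<in>V. \<Sum>j\<in>V. a i j * f i * f j * (h i - h j)\<^sup>2) / 2"
proof -
  define T where "T = (\<Sum>i\<in>V. \<Sum>j\<in>V. a i j * f i * f j * (h i)\<^sup>2)"
  define M where "M = (\<Sum>i\<in>V. \<Sum>j\<in>V. a i j * f i * f j * (h i * h j))"
  have "T = (\<Sum>i\<in>V. f i * (h i)\<^sup>2 * (\<Sum>j\<in>V. a i j * f j))"
    by (simp add: T_def sum_distrib_left mult_ac)
  also have "\<dots> = (\<Sum>i\<in>V. f i * (h i)\<^sup>2 * (l * f i))"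
    by (intro sum.cong refl) (simp add: eigenfunction)
  also have "\<dots> = l * (\<Sum>i\<in>V. f i * h i * (f i * h i))"
    by (simp add: sum_distrib_left power2_eq_square mult_ac)
  finally have T: "T = l * (\<Sum>i\<in>V. f i * h i * (f i * h i))" .
  have "T = (\<Sum>j\<in>V. \<Sum>i\<in>V. a i j * f i * f j * (h i)\<^sup>2)" unfolding T_def by (rule sum.swap)
  also have "\<dots> = (\<Sum>i\<in>V. \<Sum>j\<in>V. a i j * f i * f j * (h j)\<^sup>2)"
    by (intro sum.cong refl) (simp add: sym mult_ac)
  finally have T': "T = (\<Sum>i\<in>V. \<Sum>j\<in>V. a i j * f i * f j * (h j)\<^sup>2)" .
  have square: "c * (x - y)\<^sup>2 = c * x\<^sup>2 + c * y\<^sup>2 - 2 * (c * (x * y))" for c x y :: real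
    by (simp add: power2_eq_square algebra_simps)
  have "(\<Sum>i\<in>V. \<Sum>j\<in>V. a i j * f i * f j * (h i - h j)\<^sup>2) =
      (\<Sum>i\<in>V. \<Sum>j\<in>V. a i j * f i * f j * (h i)\<^sup>2 + a i j * f i * f j * (h j)\<^sup>2
        - 2 * (a i j * f i * f j * (h i * h j)))"
    by (intro sum.cong refl square)
  also have "\<dots> = T + T - 2 * M"
    by (subst (2) T') (simp only: T_def M_def sum.distrib sum_subtractf sum_distrib_left)
  finally have "(\<Sum>i\<in>V. \<Sum>j\<in>V. a i j * f i * f j * (h i - h j)\<^sup>2) = T + T - 2 * M" .
  moreover have "(\<Sum>i\<in>V. f i * h i * (\<Sum>j\<in>V. a i j * (f j * h j))) = M"
    by (simp add: M_def sum_distrib_left mult_ac)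
  ultimately show ?thesis by (simp add: T)
qed

text \<open>With too many classes, some nonzero combination of the restrictions of \<open>f\<close>
  to the classes would be orthogonal to all eigenvectors up to \<open>l\<close>, making the shifted
  form positive. But by \<open>edge_form\<close> it is nonpositive: a negative product
  \<open>a i j * f i * f j\<close> occurs only inside a class, where \<open>h\<close> is
  constant.\<close>

lemma card_domains_le:
  assumes R: "equiv W R"
    and edges: "\<And>i j. \<lbrakk>i \<in> V; j \<in> V; i \<noteq> j; a i j * f i * f j < 0\<rbrakk> \<Longrightarrow> (i, j) \<in> R"
  shows "card (W // R) \<le> card {p \<in> I. \<mu> p \<le> l}"
proof (rule ccontr)
  assume less: "\<not> ?thesis"
  have fin: "finite (W // R)"
    using finite_W R by (meson equiv_type finite_quotient)
  define u where "u C i = (if i \<in> C then f i else 0)" for C i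
  obtain x where x0: "\<exists>C\<in>W // R. x C \<noteq> 0"
    and x: "\<And>p. p \<in> {p \<in> I. \<mu> p \<le> l} \<Longrightarrow> (\<Sum>C\<in>W // R. ip (u C) p * x C) = 0"
    using homogeneous_system_nontrivial[of "{p \<in> I. \<mu> p \<le> l}" "W // R" "\<lambda>p C. ip (u C) p"]
      finite_I fin less by auto
  \<comment> \<open>The coefficient attached to the class of \<open>i\<close>. Outside
    \<open>W\<close> its value is harmless, since \<open>f i\<close> vanishes there.\<close>
  define h where "h i = x (R `` {i})" for i
  have gu: "f i * h i = (\<Sum>C\<in>W // R. x C * u C i)" if "i \<in> V" for i
  proof (cases "f i = 0")
    case False
    then have i: "i \<in> W" using that by simp
    have "(\<Sum>C\<in>W // R. x C * u C i) = (\<Sum>C\<in>W // R. if C = R `` {i} then f i * h i else 0)"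
    proof (intro sum.cong refl)
      fix C assume C: "C \<in> W // R"
      then obtain j where "j \<in> W" "C = R `` {j}" by (auto elim: quotientE)
      then have "i \<in> C \<longleftrightarrow> C = R `` {i}"
        using eq_equiv_class_iff[OF R \<open>j \<in> W\<close> i] equiv_class_eq_iff[OF R, of j i] i by auto
      then show "x C * u C i = (if C = R `` {i} then f i * h i else 0)"
        by (auto simp: u_def h_def)
    qed
    then show ?thesis using fin quotientI[OF i, of R] by simp
  qed (auto simp: u_def intro!: sum.neutral)
  let ?g = "\<lambda>i. f i * h i"
  have ipg: "ip ?g p = 0" if "p \<in> I" "\<mu> p \<le> l" for p
  proof -
    have "ip ?g p = (\<Sum>i\<in>V. (\<Sum>C\<in>W // R. x C * u C i) * v p i)" by (simp add: ip_def gu)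
    also have "\<dots> = (\<Sum>C\<in>W // R. x C * ip (u C) p)" unfolding ip_def by (rule sum_lincomb_swap)
    finally show ?thesis using x[of p] that by (simp add: mult.commute)
  qed
  obtain i where i: "i \<in> V" "?g i \<noteq> 0"
  proof -
    obtain C where C: "C \<in> W // R" "x C \<noteq> 0" using x0 by blast
    then obtain i where "i \<in> W" "C = R `` {i}" by (auto elim: quotientE)
    with C that[of i] show thesis by (simp add: h_def)
  qed
  then obtain p where p: "p \<in> I" "ip ?g p \<noteq> 0" by (rule ex_ip_nonzero)
  have "(\<Sum>q\<in>I. (\<mu> q - l) * (ip ?g q)\<^sup>2) > 0"
  proof (rule sum_pos2[OF finite_I p(1)])
    show "0 < (\<mu> p - l) * (ip ?g p)\<^sup>2" using p ipg[of p] by (cases "\<mu> p \<le> l") auto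
    show "0 \<le> (\<mu> q - l) * (ip ?g q)\<^sup>2" if "q \<in> I" for q
      using ipg[of q] that by (cases "\<mu> q \<le> l") auto
  qed
  moreover have "(\<Sum>i\<in>V. \<Sum>j\<in>V. a i j * f i * f j * (h i - h j)\<^sup>2) \<ge> 0"
  proof (intro sum_nonneg)
    fix i j assume ij: "i \<in> V" "j \<in> V"
    show "0 \<le> a i j * f i * f j * (h i - h j)\<^sup>2"
    proof (cases "i \<noteq> j \<and> a i j * f i * f j < 0")
      case True
      then have "(i, j) \<in> R" using edges ij by blast
      then have "h i = h j" using equiv_class_eq[OF R] by (simp add: h_def)
      then show ?thesis by simp
    next
      case False
      then have "i = j \<or> a i j * f i * f j \<ge> 0" by auto
      then show ?thesis by auto
    qed
  qed
  ultimately show False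
    using quadratic_form[of ?g l] unfolding edge_form by linarith
qed

text \<open>A graph has at least as many components as vertices minus edges. That \<open>E\<close>
  generates \<open>R\<close> is expressed by \<open>gen\<close> through real functions, which suits
  the linear algebra: a function constant along \<open>E\<close> with sum zero on every class must
  vanish.\<close>

lemma card_W_le_domains:
  assumes R: "equiv W R" and E: "finite E"
    and gen: "\<And>h :: 'v \<Rightarrow> real. \<lbrakk>\<And>i j. (i, j) \<in> E \<Longrightarrow> h i = h j\<rbrakk> \<Longrightarrow> \<forall>(i, j)\<in>R. h i = h j"
  shows "card W \<le> card (W // R) + card E"
proof (rule ccontr)
  assume less: "\<not> ?thesis"
  have fin: "finite (W // R)"
    using finite_W R by (meson equiv_type finite_quotient)
  have lt: "card ((W // R) <+> E) < card W" using less fin E by (simp add: card_Plus)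
  define c :: "'v set + 'v \<times> 'v \<Rightarrow> 'v \<Rightarrow> real"
    where "c e w = (case e of Inl C \<Rightarrow> of_bool (w \<in> C) | Inr (i, j) \<Rightarrow> of_bool (w = i) - of_bool (w = j))" for e w
  obtain h where h0: "\<exists>i\<in>W. h i \<noteq> 0"
    and h: "\<And>e. e \<in> (W // R) <+> E \<Longrightarrow> (\<Sum>i\<in>W. c e i * h i) = 0"
    using homogeneous_system_nontrivial[OF finite_Plus[OF fin E] finite_W lt, of c] by blast
  \<comment> \<open>\<open>gen\<close> speaks of functions on the whole type, hence the extension of
    \<open>h\<close> by zero off \<open>W\<close>.\<close>
  define k where "k i = (if i \<in> W then h i else 0)" for i
  have "k i = k j" if "(i, j) \<in> E" for i j
  proof -
    have "0 = (\<Sum>w\<in>W. of_bool (w = i) * h w - of_bool (w = j) * h w)"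
      using h[of "Inr (i, j)"] that by (auto simp: c_def left_diff_distrib)
    also have "\<dots> = k i - k j"
      unfolding sum_subtractf k_def using finite_W by (simp add: of_bool_def if_distrib[of "\<lambda>x. x * _"] cong: if_cong)
    finally show ?thesis by simp
  qed
  then have const: "\<forall>(i, j)\<in>R. k i = k j" by (rule gen)
  obtain i where i: "i \<in> W" "h i \<noteq> 0" using h0 by blast
  define C where "C = R `` {i}"
  have C: "C \<in> W // R" "C \<subseteq> W" "i \<in> C"
    using quotientI[OF i(1)] equiv_type[OF R] equiv_class_self[OF R i(1)] unfolding C_def by auto
  have "0 = (\<Sum>w\<in>W. of_bool (w \<in> C) * h w)" using h[OF InlI[OF C(1)]] by (simp add: c_def)
  also have "\<dots> = (\<Sum>w\<in>C. h w)"
    using C finite_W by (intro sum.mono_neutral_cong_right) auto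
  also have "\<dots> = (\<Sum>w\<in>C. h i)"
  proof (intro sum.cong refl)
    fix w assume "w \<in> C"
    then have "k i = k w" "w \<in> W" using const C by (auto simp: C_def)
    then show "h w = h i" using i by (simp add: k_def)
  qed
  finally have "card C = 0" using i by simp
  then show False using C finite_W by (metis card_0_eq empty_iff finite_subset)
qed

end

section \<open>Eigenfunctions on forests\<close>

text \<open>Acyclicity enters as the absence of nonzero circulations, a form that passes directly to
  a subset of the vertices.\<close>

locale forest_eigenfunction = symmetric_eigenfunction V a I v \<mu> f l
  for V :: "'v :: linorder set" and a I and v :: "'i \<Rightarrow> 'v \<Rightarrow> real" and \<mu> f l +
  assumes circulation_zero: "\<And>\<phi> i j. \<lbrakk>\<And>i j. \<phi> i j \<noteq> 0 \<Longrightarrow> i \<in> V \<and> j \<in> V \<and> i \<noteq> j \<and> a i j \<noteq> 0;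
      \<And>i j. \<phi> j i = - \<phi> i j; \<And>i. i \<in> V \<Longrightarrow> (\<Sum>j\<in>V. \<phi> i j) = 0\<rbrakk> \<Longrightarrow> \<phi> i j = (0 :: real)"
begin

text \<open>The flow \<open>a i j * (f j * g i - f i * g j)\<close> is a circulation.\<close>

lemma eigenfunctions_proportional_on_edges:
  assumes g: "\<And>i. i \<in> V \<Longrightarrow> (\<Sum>j\<in>V. a i j * g j) = l * g i"
    and "i \<in> V" "j \<in> V" "a i j \<noteq> 0"
  shows "f j * g i = f i * g j"
proof -
  define \<phi> where "\<phi> i j = (if i \<in> V \<and> j \<in> V then a i j * (f j * g i - f i * g j) else 0)" for i j
  have "\<phi> i j = 0"
  proof (rule circulation_zero)
    show "\<phi> i j \<noteq> 0 \<Longrightarrow> i \<in> V \<and> j \<in> V \<and> i \<noteq> j \<and> a i j \<noteq> 0" for i j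
      by (auto simp: \<phi>_def split: if_splits)
    show "\<phi> j i = - \<phi> i j" for i j by (auto simp: \<phi>_def sym algebra_simps)
    show "(\<Sum>j\<in>V. \<phi> i j) = 0" if "i \<in> V" for i
    proof -
      have "(\<Sum>j\<in>V. \<phi> i j) = g i * (\<Sum>j\<in>V. a i j * f j) - f i * (\<Sum>j\<in>V. a i j * g j)"
        using that by (simp add: \<phi>_def sum_subtractf[symmetric] sum_distrib_left algebra_simps)
      then show ?thesis using that by (simp add: g eigenfunction)
    qed
  qed
  then show ?thesis using assms by (simp add: \<phi>_def)
qed

end

text \<open>The situation reached once the vertices of \<open>zero_nbhd_set\<close> are
  deleted.\<close>

locale full_forest_eigenfunction = forest_eigenfunction V a I v \<mu> f l
  for V :: "'v :: linorder set" and a I and v :: "'i \<Rightarrow> 'v \<Rightarrow> real" and \<mu> f l +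
  assumes nonzero_neighbour: "i \<in> V \<Longrightarrow> f i = 0 \<Longrightarrow> \<exists>j\<in>V. a i j \<noteq> 0 \<and> f j \<noteq> 0"
begin

abbreviation Z :: "'v set" where "Z \<equiv> {i \<in> V. f i = 0}"

text \<open>For a neighbour \<open>j\<close> of \<open>z\<close> with \<open>f j\<close> nonzero,
  proportionality along the edge reads \<open>f j * g z = 0\<close>.\<close>

lemma eigenfunction_zero:
  assumes "\<And>i. i \<in> V \<Longrightarrow> (\<Sum>j\<in>V. a i j * g j) = l * g i" and "z \<in> Z"
  shows "g z = 0"
  using nonzero_neighbour[of z] eigenfunctions_proportional_on_edges[OF assms(1), of z] assms(2)
  by fastforce

definition EW :: "('v \<times> 'v) set" where
  "EW = {(i, j). i \<in> W \<and> j \<in> W \<and> i < j \<and> a i j \<noteq> 0}"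

lemma finite_EW: "finite EW"
  by (rule finite_subset[of _ "W \<times> W"]) (auto simp: EW_def finite_W)

text \<open>In the space of functions on \<open>W\<close>, the quotients \<open>g / f\<close> of eigenfunctions are orthogonal to the
divergences of the flows supported on the edges inside \<open>W\<close> and of the flows
\<open>w \<mapsto> a z w * f w\<close> from \<open>W\<close> into a fixed zero \<open>z\<close>; the latter have divergence zero at \<open>z\<close>, and
all these flows have linearly independent divergences since there are no circulations.\<close>

lemma card_eigenvalue_edges_le:
  "card {p \<in> I. \<mu> p = l} + card EW + card Z \<le> card W"
proof (rule ccontr)
  assume less: "\<not> ?thesis"
  let ?K = "{p \<in> I. \<mu> p = l}"
  let ?U = "?K <+> (EW <+> Z)"
  define flow :: "('v \<times> 'v) + 'v \<Rightarrow> 'v \<Rightarrow> 'v \<Rightarrow> real" where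
    "flow e i j = (case e of Inl e \<Rightarrow> of_bool (e = (i, j))
        | Inr z \<Rightarrow> if z = j then of_bool (i \<in> W) * (a j i * f i) else 0)" for e i j
  \<comment> \<open>Row \<open>w\<close> collects the values at \<open>w\<close> of all the vectors
    concerned: the quotients \<open>v p / f\<close>, and the divergences of the edge flows and of
    the flows into the zeros.\<close>
  define c where "c w e = (case e of Inl p \<Rightarrow> v p w / f w
      | Inr e \<Rightarrow> (\<Sum>j\<in>V. flow e w j - flow e j w))" for w and e :: "'i + ('v \<times> 'v) + 'v"
  have finZ: "finite Z" using finite_V by simp
  have "card W < card ?U" using less finite_I finite_EW finZ by (simp add: card_Plus)
  then obtain x where x0: "\<exists>e\<in>?U. x e \<noteq> 0"
    and x: "\<And>w. w \<in> W \<Longrightarrow> (\<Sum>e\<in>?U. c w e * x e) = 0"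
    using homogeneous_system_nontrivial[of W ?U c] finite_W finite_I finite_EW finZ by auto
  define g where "g i = (\<Sum>p\<in>?K. x (Inl p) * v p i)" for i
  \<comment> \<open>Division by zero gives 0, so \<open>h\<close> vanishes on
    \<open>Z\<close>.\<close>
  define h where "h i = g i / f i" for i
  define M where "M i j = (\<Sum>e\<in>EW <+> Z. x (Inr e) * flow e i j)" for i j
  have M: "M i j = (if (i, j) \<in> EW then x (Inr (Inl (i, j))) else 0) +
      (if i \<in> W \<and> j \<in> Z then x (Inr (Inr j)) * (a j i * f i) else 0)" for i j
  proof -
    have "(\<Sum>e\<in>EW. x (Inr (Inl e)) * flow (Inl e) i j) = (\<Sum>e\<in>EW. if e = (i, j) then x (Inr (Inl e)) else 0)"
      by (intro sum.cong refl) (simp add: flow_def)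
    moreover have "(\<Sum>z\<in>Z. x (Inr (Inr z)) * flow (Inr z) i j) =
        (\<Sum>z\<in>Z. if z = j then x (Inr (Inr z)) * (of_bool (i \<in> W) * (a j i * f i)) else 0)"
      by (intro sum.cong refl) (simp add: flow_def)
    ultimately show ?thesis using finite_EW finZ by (simp add: M_def sum.Plus)
  qed
  define \<phi> where "\<phi> i j = M i j - M j i" for i j
  \<comment> \<open>The linear relation rewritten: \<open>h\<close> plus the divergence of the
    combined flow \<open>\<phi>\<close> is zero on \<open>W\<close>.\<close>
  have eq: "h w + (\<Sum>j\<in>V. \<phi> w j) = 0" if w: "w \<in> W" for w
  proof -
    have "0 = (\<Sum>p\<in>?K. c w (Inl p) * x (Inl p)) + (\<Sum>e\<in>EW <+> Z. c w (Inr e) * x (Inr e))"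
      using x[OF w] finite_I finite_EW finZ by (simp add: sum.Plus)
    also have "(\<Sum>p\<in>?K. c w (Inl p) * x (Inl p)) = h w"
      by (simp add: c_def h_def g_def sum_divide_distrib mult_ac)
    also have "(\<Sum>e\<in>EW <+> Z. c w (Inr e) * x (Inr e)) = (\<Sum>e\<in>EW <+> Z. \<Sum>j\<in>V. x (Inr e) * flow e w j - x (Inr e) * flow e j w)"
      by (intro sum.cong refl) (simp add: c_def sum_distrib_left sum_distrib_right left_diff_distrib right_diff_distrib mult.commute)
    also have "\<dots> = (\<Sum>j\<in>V. \<Sum>e\<in>EW <+> Z. x (Inr e) * flow e w j - x (Inr e) * flow e j w)"
      by (rule sum.swap)
    also have "\<dots> = (\<Sum>j\<in>V. \<phi> w j)" by (simp add: \<phi>_def M_def sum_subtractf)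
    finally show ?thesis by simp
  qed
  have g: "(\<Sum>j\<in>V. a i j * g j) = l * g i" if "i \<in> V" for i
  proof -
    have "(\<Sum>j\<in>V. a i j * g j) = (\<Sum>j\<in>V. (\<Sum>p\<in>?K. x (Inl p) * v p j) * a i j)"
      by (simp add: g_def mult.commute)
    also have "\<dots> = (\<Sum>p\<in>?K. x (Inl p) * (\<Sum>j\<in>V. v p j * a i j))" by (rule sum_lincomb_swap)
    also have "\<dots> = (\<Sum>p\<in>?K. x (Inl p) * (l * v p i))"
      using eigen that by (intro sum.cong refl) (simp add: mult.commute)
    finally show ?thesis by (simp add: g_def sum_distrib_left mult_ac)
  qed
  have gZ: "g z = 0" if "z \<in> Z" for z using eigenfunction_zero[OF g that] .
  have hE: "h i = h j" if "(i, j) \<in> EW" for i j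
    using that eigenfunctions_proportional_on_edges[OF g, of i j]
    by (auto simp: EW_def h_def field_simps)
  have gh: "g i = f i * h i" if "i \<in> V" for i
    using that gZ[of i] by (cases "f i = 0") (auto simp: h_def)
  \<comment> \<open>Orthogonality by summation by parts: edges inside \<open>W\<close> contribute
    nothing as \<open>h\<close> is constant along them, and the flow into a zero \<open>z\<close>
    contributes a multiple of \<open>l * g z = 0\<close>. Together with \<open>eq\<close> this makes
    the sum of the squares of \<open>h\<close> vanish.\<close>
  have "(\<Sum>w\<in>V. h w * (\<Sum>j\<in>V. \<phi> w j)) = 0"
  proof -
    have "(\<Sum>w\<in>V. h w * (\<Sum>j\<in>V. \<phi> w j)) = (\<Sum>i\<in>V. \<Sum>j\<in>V. h i * M i j) - (\<Sum>i\<in>V. \<Sum>j\<in>V. h i * M j i)"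
      by (simp add: \<phi>_def sum_distrib_left sum_subtractf algebra_simps)
    also have "(\<Sum>i\<in>V. \<Sum>j\<in>V. h i * M j i) = (\<Sum>i\<in>V. \<Sum>j\<in>V. h j * M i j)" by (rule sum.swap)
    also have "(\<Sum>i\<in>V. \<Sum>j\<in>V. h i * M i j) - (\<Sum>i\<in>V. \<Sum>j\<in>V. h j * M i j) =
        (\<Sum>i\<in>V. \<Sum>j\<in>V. (h i - h j) * M i j)"
      by (simp add: sum_subtractf algebra_simps)
    also have "\<dots> = (\<Sum>i\<in>V. \<Sum>j\<in>V. if j \<in> Z then x (Inr (Inr j)) * (a j i * g i) else 0)"
    proof (intro sum.cong refl)
      fix i j assume ij: "i \<in> V" "j \<in> V"
      show "(h i - h j) * M i j = (if j \<in> Z then x (Inr (Inr j)) * (a j i * g i) else 0)"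
      proof (cases "j \<in> Z")
        case True
        then have "h j = 0" by (simp add: h_def)
        with True ij show ?thesis by (auto simp: M EW_def gh gZ)
      next
        case False
        then show ?thesis using hE by (auto simp: M)
      qed
    qed
    also have "\<dots> = (\<Sum>j\<in>V. \<Sum>i\<in>V. if j \<in> Z then x (Inr (Inr j)) * (a j i * g i) else 0)"
      by (rule sum.swap)
    also have "\<dots> = (\<Sum>j\<in>V. if j \<in> Z then x (Inr (Inr j)) * (l * g j) else 0)"
      by (intro sum.cong refl) (auto simp: sum_distrib_left[symmetric] g)
    also have "\<dots> = 0" by (intro sum.neutral) (auto simp: gZ)
    finally show ?thesis .
  qed
  moreover have "(\<Sum>w\<in>V. h w * (\<Sum>j\<in>V. \<phi> w j)) = (\<Sum>w\<in>V. - (h w * h w))"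
  proof (intro sum.cong refl)
    fix w assume "w \<in> V"
    show "h w * (\<Sum>j\<in>V. \<phi> w j) = - (h w * h w)"
    proof (cases "f w = 0")
      case False
      then have "(\<Sum>j\<in>V. \<phi> w j) = - h w" using eq[of w] \<open>w \<in> V\<close> by simp
      then show ?thesis by simp
    qed (simp add: h_def)
  qed
  ultimately have "(\<Sum>w\<in>V. h w * h w) = 0" by (simp add: sum_negf)
  then have "\<forall>w\<in>V. h w * h w = 0"
    by (subst (asm) sum_nonneg_eq_0_iff) (auto simp: finite_V)
  then have h0: "h w = 0" if "w \<in> V" for w using that by simp
  have xK: "x (Inl p) = 0" if "p \<in> ?K" for p
  proof (rule ccontr)
    assume "x (Inl p) \<noteq> 0"
    then obtain i where "i \<in> V" "g i \<noteq> 0"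
      using lincomb_nonzero[of ?K p "\<lambda>p. x (Inl p)"] \<open>p \<in> ?K\<close> unfolding g_def by auto
    then show False using gh h0 by simp
  qed
  \<comment> \<open>Now \<open>h = 0\<close>, so \<open>\<phi>\<close> has no divergence on
    \<open>W\<close>; at a zero \<open>i\<close> its divergence is a multiple of
    \<open>l * f i = 0\<close>.\<close>
  have \<phi>0: "\<phi> i j = 0" for i j
  proof (rule circulation_zero)
    show "\<phi> i j \<noteq> 0 \<Longrightarrow> i \<in> V \<and> j \<in> V \<and> i \<noteq> j \<and> a i j \<noteq> 0" for i j
      using sym by (auto simp: \<phi>_def M EW_def split: if_splits)
    show "\<phi> j i = - \<phi> i j" for i j by (simp add: \<phi>_def)
    show "(\<Sum>j\<in>V. \<phi> i j) = 0" if i: "i \<in> V" for i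
    proof (cases "i \<in> W")
      case True
      then show ?thesis using eq[OF True] h0 by simp
    next
      case False
      then have "(\<Sum>j\<in>V. \<phi> i j) = (\<Sum>j\<in>V. - (x (Inr (Inr i)) * (a i j * f j)))"
        using i by (intro sum.cong refl) (auto simp: \<phi>_def M EW_def)
      also have "\<dots> = - x (Inr (Inr i)) * (l * f i)"
        using i by (simp add: sum_negf sum_distrib_left[symmetric] eigenfunction)
      finally show ?thesis using False i by simp
    qed
  qed
  have xE: "x (Inr (Inl (i, j))) = 0" if "(i, j) \<in> EW" for i j
    using \<phi>0[of i j] that by (auto simp: \<phi>_def M EW_def)
  have xZ: "x (Inr (Inr z)) = 0" if z: "z \<in> Z" for z
  proof -
    obtain y where "y \<in> W" "a z y \<noteq> 0" using nonzero_neighbour z by blast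
    then show ?thesis using \<phi>0[of y z] z by (auto simp: \<phi>_def M EW_def)
  qed
  show False using x0 xK xE xZ by auto
qed

text \<open>Write \<open>s\<close>, \<open>s'\<close> for the class numbers, \<open>n0\<close> for
  the multiplicity of \<open>l\<close>, and \<open>e\<close> for \<open>card EW\<close>. Then
  \<open>2 * card W \<le> s + s' + e \<le> card V + n0 + e \<le> 2 * card W\<close>, the last step
  by \<open>card_eigenvalue_edges_le\<close>. Hence both upper bounds on the class numbers are
  attained.\<close>

lemma card_domains:
  assumes R: "equiv W R" and R': "equiv W R'"
    and edges: "\<And>i j. \<lbrakk>i \<in> V; j \<in> V; i \<noteq> j; a i j * f i * f j < 0\<rbrakk> \<Longrightarrow> (i, j) \<in> R"
    and edges': "\<And>i j. \<lbrakk>i \<in> V; j \<in> V; i \<noteq> j; a i j * f i * f j > 0\<rbrakk> \<Longrightarrow> (i, j) \<in> R'"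
    and gen: "\<And>h :: 'v \<Rightarrow> real. \<lbrakk>\<And>i j. \<lbrakk>i \<in> V; j \<in> V; i \<noteq> j; a i j * f i * f j < 0\<rbrakk> \<Longrightarrow> h i = h j\<rbrakk>
       \<Longrightarrow> \<forall>(i, j)\<in>R. h i = h j"
    and gen': "\<And>h :: 'v \<Rightarrow> real. \<lbrakk>\<And>i j. \<lbrakk>i \<in> V; j \<in> V; i \<noteq> j; a i j * f i * f j > 0\<rbrakk> \<Longrightarrow> h i = h j\<rbrakk>
       \<Longrightarrow> \<forall>(i, j)\<in>R'. h i = h j"
  shows "card (W // R) = card {p \<in> I. \<mu> p < l} + card {p \<in> I. \<mu> p = l}"
    and "card (W // R') = card {p \<in> I. \<mu> p > l} + card {p \<in> I. \<mu> p = l}"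
proof -
  interpret N: symmetric_eigenfunction V "\<lambda>i j. - a i j" I v "\<lambda>p. - \<mu> p" f "- l"
    by (rule eigenfunction_negate)
  define En where "En = {(i, j) \<in> EW. a i j * f i * f j < 0}"
  define Ep where "Ep = {(i, j) \<in> EW. a i j * f i * f j > 0}"
  have fin: "finite En" "finite Ep" by (auto simp: En_def Ep_def intro: finite_subset[OF _ finite_EW])
  have "EW = En \<union> Ep" by (auto simp: En_def Ep_def EW_def linorder_neq_iff zero_less_mult_iff mult_less_0_iff)
  moreover have "En \<inter> Ep = {}" by (auto simp: En_def Ep_def)
  ultimately have EW: "card EW = card En + card Ep" using fin by (simp add: card_Un_disjoint)
  have S: "card (W // R) \<le> card {p \<in> I. \<mu> p < l} + card {p \<in> I. \<mu> p = l}"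
    using card_domains_le[OF R edges] by (simp add: card_le_conv)
  have S': "card (W // R') \<le> card {p \<in> I. \<mu> p > l} + card {p \<in> I. \<mu> p = l}"
    using N.card_domains_le[OF R'] edges' N.card_le_conv[of "- l"] by simp
  have "card W \<le> card (W // R) + card En"
  proof (rule card_W_le_domains[OF R fin(1) gen])
    fix h :: "'v \<Rightarrow> real" and i j
    assume h: "\<And>i j. (i, j) \<in> En \<Longrightarrow> h i = h j" and ij: "i \<in> V" "j \<in> V" "i \<noteq> j" "a i j * f i * f j < 0"
    then have "(i, j) \<in> En \<or> (j, i) \<in> En"
      by (cases "i < j") (auto simp: En_def EW_def sym mult_ac)
    then show "h i = h j" using h by metis
  qed
  moreover have "card W \<le> card (W // R') + card Ep"
  proof (rule card_W_le_domains[OF R' fin(2) gen'])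
    fix h :: "'v \<Rightarrow> real" and i j
    assume h: "\<And>i j. (i, j) \<in> Ep \<Longrightarrow> h i = h j" and ij: "i \<in> V" "j \<in> V" "i \<noteq> j" "a i j * f i * f j > 0"
    then have "(i, j) \<in> Ep \<or> (j, i) \<in> Ep"
      by (cases "i < j") (auto simp: Ep_def EW_def sym mult_ac)
    then show "h i = h j" using h by metis
  qed
  moreover have "card W + card Z = card V"
  proof -
    have "V = W \<union> Z" by auto
    then have "card V = card (W \<union> Z)" by simp
    then show ?thesis using finite_V by (subst (asm) card_Un_disjoint) auto
  qed
  moreover note card_trichotomy[of l] card_eigenvalue_edges_le EW S S'
  ultimately show "card (W // R) = card {p \<in> I. \<mu> p < l} + card {p \<in> I. \<mu> p = l}"
    and "card (W // R') = card {p \<in> I. \<mu> p > l} + card {p \<in> I. \<mu> p = l}"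
    by linarith+
qed

end

subsection \<open>Transfer to matrices\<close>

text \<open>The basis consists of the columns of \<open>Q\<close>; completeness holds because a left
  inverse of a square matrix is also a right inverse.\<close>

lemma symmetric_mat_eigenbasis:
  fixes A :: "real mat"
  assumes A: "A \<in> carrier_mat n n" and sym: "A\<^sup>T = A"
  obtains v \<mu> where "symmetric_eigenbasis {..<n} (\<lambda>i j. A $$ (i, j)) {..<n} v \<mu>"
    and "char_poly A = (\<Prod>a\<leftarrow>map \<mu> [0..<n]. [:- a, 1:])"
proof -
  obtain Q D where Q: "Q \<in> carrier_mat n n" and D: "D \<in> carrier_mat n n"
    and QQ: "Q\<^sup>T * Q = 1\<^sub>m n" and AQ: "A * Q = Q * D" and diag: "diagonal_mat D"
    using real_symmetric_diagonalization[OF A sym] by blast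
  have QQ': "Q * Q\<^sup>T = 1\<^sub>m n" using mat_mult_left_right_inverse[OF _ Q QQ] Q by simp
  define \<mu> where "\<mu> p = D $$ (p, p)" for p
  define v where "v p i = Q $$ (i, p)" for p i
  have "symmetric_eigenbasis {..<n} (\<lambda>i j. A $$ (i, j)) {..<n} v \<mu>"
  proof
    show "finite {..<n}" by simp
  next
    fix i j assume "i \<in> {..<n}" "j \<in> {..<n}"
    then show "A $$ (i, j) = A $$ (j, i)" using arg_cong[OF sym, of "\<lambda>M. M $$ (i, j)"] A by simp
  next
    fix p i assume pi: "p \<in> {..<n}" "i \<in> {..<n}"
    have "(\<Sum>j<n. A $$ (i, j) * v p j) = (A * Q) $$ (i, p)"
      using A Q pi by (simp add: v_def scalar_prod_def lessThan_atLeast0)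
    also have "\<dots> = (\<Sum>j<n. Q $$ (i, j) * D $$ (j, p))"
      unfolding AQ using D Q pi by (simp add: scalar_prod_def lessThan_atLeast0)
    also have "\<dots> = (\<Sum>j<n. if j = p then Q $$ (i, j) * D $$ (j, p) else 0)"
      using diag D pi by (intro sum.cong refl) (auto simp: diagonal_mat_def)
    finally show "(\<Sum>j<n. A $$ (i, j) * v p j) = \<mu> p * v p i"
      using pi by (simp add: v_def \<mu>_def)
  next
    fix p q assume pq: "p \<in> {..<n}" "q \<in> {..<n}"
    have "(\<Sum>i<n. v p i * v q i) = (Q\<^sup>T * Q) $$ (p, q)"
      using Q pq by (simp add: v_def scalar_prod_def lessThan_atLeast0)
    then show "(\<Sum>i<n. v p i * v q i) = of_bool (p = q)" using pq by (simp add: QQ)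
  next
    fix i j assume ij: "i \<in> {..<n}" "j \<in> {..<n}"
    have "(\<Sum>p<n. v p i * v p j) = (Q * Q\<^sup>T) $$ (i, j)"
      using Q ij by (simp add: v_def scalar_prod_def lessThan_atLeast0)
    then show "(\<Sum>p<n. v p i * v p j) = of_bool (i = j)" using ij by (simp add: QQ')
  qed
  moreover have "char_poly A = (\<Prod>a\<leftarrow>map \<mu> [0..<n]. [:- a, 1:])"
  proof -
    have "A = A * (Q * Q\<^sup>T)" using A by (simp add: QQ')
    also have "\<dots> = Q * D * Q\<^sup>T" using A Q by (simp add: AQ[symmetric] assoc_mult_mat[of _ n n _ n _ n])
    finally have "similar_mat_wit A D Q (Q\<^sup>T)"
      using A D Q by (intro similar_mat_witI[of _ _ n]) (auto simp: QQ QQ')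
    then have "char_poly A = char_poly D" by (intro char_poly_similar) (auto simp: similar_mat_def)
    also have "\<dots> = (\<Prod>a\<leftarrow>diag_mat D. [:- a, 1:])"
      using D diag by (intro char_poly_upper_triangular) (auto simp: diagonal_mat_def)
    also have "diag_mat D = map \<mu> [0..<n]" using D by (simp add: diag_mat_def \<mu>_def)
    finally show ?thesis .
  qed
  ultimately show thesis by (rule that)
qed

section \<open>Eigenvalue lists and characteristic polynomials\<close>

lemma order_prod_linear_factors:
  fixes x :: "'a :: idom"
  shows "order x (\<Prod>a\<leftarrow>ls. [:- a, 1:]) = count_list ls x"
proof (induction ls)
  case (Cons a ls)
  have "(\<Prod>a\<leftarrow>a # ls. [:- a, 1:]) \<noteq> 0" by (auto simp only: prod_list_zero_iff) auto
  then have "order x (\<Prod>a\<leftarrow>a # ls. [:- a, 1:]) = order x [:- a, 1:] + count_list ls x"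
    unfolding list.map prod_list.Cons Cons.IH[symmetric] by (rule order_mult)
  moreover have "order x [:- a, 1:] = (if a = x then 1 else 0)"
    by (auto simp: order_linear intro!: order_0I)
  ultimately show ?case by simp
qed simp

text \<open>The order of the polynomial at each point fixes how often that point occurs in a list of
  roots, and a sorted list is determined by its multiset. This gives the uniqueness behind
  \<open>THE\<close>.\<close>

lemma eigvals_list_eqI:
  assumes "char_poly A = (\<Prod>a\<leftarrow>ls. [:- a, 1:])"
  shows "eigvals_list A = sort ls"
  unfolding eigvals_list_def
proof (rule the_equality)
  have "(\<Prod>a\<leftarrow>sort ls. [:- a, 1:]) = (\<Prod>a\<leftarrow>ls. [:- a, 1:] :: real poly)"
    by (simp flip: prod_mset_prod_list)
  then show "sorted (sort ls) \<and> char_poly A = (\<Prod>a\<leftarrow>sort ls. [:- a, 1:])" using assms by simp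
next
  fix xs assume xs: "sorted xs \<and> char_poly A = (\<Prod>a\<leftarrow>xs. [:- a, 1:])"
  have "mset xs = mset ls"
  proof (rule multiset_eqI)
    fix x
    show "count (mset xs) x = count (mset ls) x"
      using order_prod_linear_factors[of x xs] order_prod_linear_factors[of x ls] xs assms
      by (simp add: count_mset)
  qed
  then show "xs = sort ls" using xs properties_for_sort by metis
qed

lemma card_eigvals_list:
  assumes "char_poly A = (\<Prod>a\<leftarrow>map \<mu> [0..<n]. [:- a, 1:])"
  shows "card {p \<in> {..<n}. P (\<mu> p)} = card {i. i < n \<and> P (eigvals_list A ! i)}"
proof -
  let ?xs = "map \<mu> [0..<n]"
  have "card {p \<in> {..<n}. P (\<mu> p)} = length (filter P ?xs)"
    by (auto simp: length_filter_conv_card intro!: arg_cong[where f = card])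
  also have "\<dots> = length (filter P (sort ?xs))"
    by (metis mset_filter mset_sort size_mset)
  also have "\<dots> = card {i. i < n \<and> P (eigvals_list A ! i)}"
    by (simp add: length_filter_conv_card eigvals_list_eqI[OF assms])
  finally show ?thesis .
qed

lemma order_char_poly_eq_card:
  fixes \<mu> :: "nat \<Rightarrow> 'a :: idom"
  assumes "char_poly A = (\<Prod>a\<leftarrow>map \<mu> [0..<n]. [:- a, 1:])"
  shows "order l (char_poly A) = card {p \<in> {..<n}. \<mu> p = l}"
proof -
  have "order l (char_poly A) = count_list (map \<mu> [0..<n]) l"
    unfolding assms by (rule order_prod_linear_factors)
  also have "\<dots> = card {p \<in> {..<n}. \<mu> p = l}"
    by (auto simp: count_list_eq_length_filter length_filter_conv_card intro!: arg_cong[where f = card])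
  finally show ?thesis .
qed

text \<open>\<open>pick\<close> enumerates a set in increasing order. Since \<open>- F\<close> is
  infinite, the enumeration is injective; its first elements stay below \<open>n\<close>, and
  counting shows that they exhaust the target.\<close>

lemma bij_betw_pick:
  assumes "finite F" "F \<subseteq> {..<n}"
  shows "bij_betw (pick (- F)) {..<card {i. i < n \<and> i \<in> - F}} ({..<n} - F)"
proof -
  have eq: "{i. i < n \<and> i \<in> - F} = {..<n} - F" by auto
  let ?m = "card ({..<n} - F)"
  have inf: "infinite (- F)" using assms(1) by (simp add: Compl_eq_Diff_UNIV)
  have inj: "inj_on (pick (- F)) {..<?m}"
    using pick_eq_iff_inf[OF inf] by (auto intro: inj_onI)
  have "pick (- F) ` {..<?m} \<subseteq> {..<n} - F"
    using pick_in_set_inf[OF inf] pick_le[of _ n "- F", unfolded eq] by auto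
  moreover have "card (pick (- F) ` {..<?m}) = ?m" using card_image[OF inj] by simp
  ultimately have "pick (- F) ` {..<?m} = {..<n} - F" by (intro card_subset_eq) auto
  with inj show ?thesis unfolding eq by (simp add: bij_betw_def)
qed

text \<open>\<open>sig\<close> is minus the sign of the entry. For a zero entry both products are 0,
  so the equivalence also holds off the edges.\<close>

lemma signed_edge_pos_iff: "x * sig A i j * y > 0 \<longleftrightarrow> A $$ (i, j) * x * y < 0"
proof -
  have "sig A i j = - sgn (A $$ (i, j))" by (simp add: sig_def sgn_real_def)
  then show ?thesis by (auto simp: sgn_real_def zero_less_mult_iff mult_less_0_iff)
qed

lemma const_on_strong_rel:
  assumes "\<And>i j. \<lbrakk>adj A i j; f i * s i j * f j > 0\<rbrakk> \<Longrightarrow> h i = h j"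
  shows "\<forall>(i, j)\<in>strong_rel A s f. h i = h j"
proof -
  have "h i = h j" if "(i, j) \<in> {(i, j). adj A i j \<and> f i * s i j * f j > 0}\<^sup>*" for i j
    using that by induction (auto dest: assms)
  then show ?thesis by (auto simp: strong_rel_conv_rtrancl)
qed

lemma edge_in_strong_rel:
  assumes "adj A i j" "f i * s i j * f j > 0"
  shows "(i, j) \<in> strong_rel A s f"
  using assms by (auto simp: strong_rel_conv_rtrancl nonzero_set_def adj_def)

theorem theorem5p2:
  fixes A :: "real mat" and n k r :: nat and f :: "real vec"
  assumes "A \<in> carrier_mat n n"
    and "transpose_mat A = A"
    and "\<not> has_cycle A"
    and "1 \<le> k" and "1 \<le> r" and "k + r - 1 \<le> n"
    and "\<forall>i. k \<le> i \<and> i \<le> k + r - 1 \<longrightarrow> eigvals_list A ! (i - 1) = eigvals_list A ! (k - 1)"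
    and "2 \<le> k \<longrightarrow> eigvals_list A ! (k - 2) < eigvals_list A ! (k - 1)"
    and "k + r \<le> n \<longrightarrow> eigvals_list A ! (k - 1) < eigvals_list A ! (k + r - 1)"
    and "eigenvector A f (eigvals_list A ! (k - 1))"
  shows "let lam = eigvals_list A ! (k - 1);
             F = zero_nbhd_set A (($) f);
             At = submatrix A (- F) (- F);
             rt = order lam (char_poly At);
             S = num_strong_nodal_domains A (sig A) (($) f);
             Sbar = num_strong_nodal_domains A (\<lambda>i j. - sig A i j) (($) f)
         in r \<ge> rt \<and>
            (\<exists>c1 c2 :: nat. c1 + c2 + (r - rt) = card F \<and>
               int S = int (k + r - 1) - int (card F) + int c1 \<and>
               int Sbar = int (n - k + 1) - int (card F) + int c2) \<and>
            (F = {} \<longrightarrow> S = k + r - 1 \<and> Sbar = n - k + 1)"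
proof -
  note A = assms(1) and sym = assms(2) and forest = assms(3)
  define l where "l = eigvals_list A ! (k - 1)"
  define F where "F = zero_nbhd_set A (($) f)"
  define V where "V = {..<n} - F"
  define m where "m = card {i. i < n \<and> i \<in> - F}"
  define At where "At = submatrix A (- F) (- F)"
  let ?a = "\<lambda>i j. A $$ (i, j)"
  have dim: "dim_row A = n" "dim_col A = n" using A by auto
  have symA: "A $$ (i, j) = A $$ (j, i)" if "i < n" "j < n" for i j
    using arg_cong[OF sym, of "\<lambda>M. M $$ (i, j)"] A that by simp
  have adj_sym: "adj A j i" if "adj A i j" for i j
    using that symA[of i j] by (auto simp: adj_def dim)
  have F: "F \<subseteq> {..<n}" "finite F"
    by (auto simp: F_def zero_nbhd_set_def dim intro: finite_subset[of _ "{..<n}"])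
  have fF: "f $ i = 0" if "i \<in> F" for i using that by (simp add: F_def zero_nbhd_set_def)

  obtain v \<mu> where basis: "symmetric_eigenbasis {..<n} ?a {..<n} v \<mu>"
    and char_A: "char_poly A = (\<Prod>a\<leftarrow>map \<mu> [0..<n]. [:- a, 1:])"
    using symmetric_mat_eigenbasis[OF A sym] by blast
  interpret B: symmetric_eigenbasis "{..<n}" ?a "{..<n}" v \<mu> by (rule basis)

  have pick: "bij_betw (pick (- F)) {..<m} V"
    unfolding m_def V_def by (rule bij_betw_pick[OF F(2,1)])
  have At: "At \<in> carrier_mat m m"
    by (auto simp: At_def m_def dim_submatrix dim)
  have At_nth: "At $$ (i, j) = A $$ (pick (- F) i, pick (- F) j)" if "i < m" "j < m" for i j
    using that unfolding At_def m_def by (intro submatrix_index) (auto simp: dim)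
  have pick_lt: "pick (- F) i < n" if "i < m" for i
    using bij_betwE[OF pick] that by (auto simp: V_def)
  have "At\<^sup>T = At"
    using At by (intro eq_matI) (auto simp: At_nth pick_lt symA)
  then obtain v' \<mu>' where basis': "symmetric_eigenbasis {..<m} (\<lambda>i j. At $$ (i, j)) {..<m} v' \<mu>'"
    and char_At: "char_poly At = (\<Prod>a\<leftarrow>map \<mu>' [0..<m]. [:- a, 1:])"
    using symmetric_mat_eigenbasis[OF At] by blast
  have "symmetric_eigenbasis {..<m} (\<lambda>i j. A $$ (pick (- F) i, pick (- F) j)) {..<m} v' \<mu>'"
    using basis' unfolding symmetric_eigenbasis_def by (simp add: At_nth)
  then have basis_V: "symmetric_eigenbasis V ?a {..<m} (\<lambda>p x. v' p (the_inv_into {..<m} (pick (- F)) x)) \<mu>'"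
    using pick by (rule symmetric_eigenbasis_reindex)
  define w where "w p x = v' p (the_inv_into {..<m} (pick (- F)) x)" for p x
  note basis_V = basis_V[folded w_def]

  have eig: "(\<Sum>j<n. A $$ (i, j) * f $ j) = l * f $ i" if "i < n" for i
  proof -
    have f: "f \<in> carrier_vec n" "A *\<^sub>v f = l \<cdot>\<^sub>v f"
      using assms(10) A by (auto simp: eigenvector_def l_def)
    show ?thesis using arg_cong[OF f(2), of "\<lambda>w. w $ i"] f(1) A that
      by (simp add: scalar_prod_def lessThan_atLeast0)
  qed
  interpret D: symmetric_eigenbasis V ?a "{..<m}" w \<mu>' by (rule basis_V)
  \<comment> \<open>Deleting \<open>F\<close> leaves \<open>f\<close> an eigenfunction because
    \<open>f\<close> vanishes there. A circulation on \<open>V\<close> is one on the whole forest,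
    and a nonzero neighbour of a remaining zero lies outside \<open>F\<close>.\<close>
  interpret D: full_forest_eigenfunction V ?a "{..<m}" w \<mu>' "($) f" l
  proof
    fix i assume i: "i \<in> V"
    have "(\<Sum>j<n. A $$ (i, j) * f $ j) = (\<Sum>j\<in>V. A $$ (i, j) * f $ j)"
      by (intro sum.mono_neutral_right) (auto simp: V_def fF)
    then show "(\<Sum>j\<in>V. A $$ (i, j) * f $ j) = l * f $ i" using eig i by (simp add: V_def)
  next
    fix \<phi> :: "nat \<Rightarrow> nat \<Rightarrow> real" and i j
    assume supp: "\<And>i j. \<phi> i j \<noteq> 0 \<Longrightarrow> i \<in> V \<and> j \<in> V \<and> i \<noteq> j \<and> A $$ (i, j) \<noteq> 0"
      and anti: "\<And>i j. \<phi> j i = - \<phi> i j" and div: "\<And>i. i \<in> V \<Longrightarrow> (\<Sum>j\<in>V. \<phi> i j) = 0"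
    show "\<phi> i j = 0"
    proof (rule forest_circulation_zero[OF forest _ anti])
      show "adj A i j" if "\<phi> i j \<noteq> 0" for i j
        using supp[OF that] by (auto simp: adj_def dim V_def)
      show "(\<Sum>j<dim_row A. \<phi> i j) = 0" for i
      proof (cases "i \<in> V")
        case True
        have "(\<Sum>j<dim_row A. \<phi> i j) = (\<Sum>j\<in>V. \<phi> i j)"
          using supp by (intro sum.mono_neutral_right) (auto simp: V_def dim)
        then show ?thesis using div[OF True] by simp
      next
        case False
        then show ?thesis using supp by (intro sum.neutral) blast
      qed
    qed
  next
    fix i assume "i \<in> V" "f $ i = 0"
    then obtain j where "adj A i j" "f $ j \<noteq> 0"
      by (auto simp: V_def F_def zero_nbhd_set_def dim)
    then show "\<exists>j\<in>V. A $$ (i, j) \<noteq> 0 \<and> f $ j \<noteq> 0"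
      using fF by (intro bexI[of _ j]) (auto simp: adj_def V_def dim)
  qed

  \<comment> \<open>The support is untouched by the deletion, so the domains of the original graph
    can be counted inside \<open>V\<close>.\<close>
  have W: "D.W = nonzero_set A (($) f)" by (auto simp: nonzero_set_def V_def dim fF)
  define R where "R = strong_rel A (sig A) (($) f)"
  define R' where "R' = strong_rel A (\<lambda>i j. - sig A i j) (($) f)"
  have adj_V: "adj A i j" if "i \<in> V" "j \<in> V" "i \<noteq> j" "A $$ (i, j) \<noteq> 0" for i j
    using that by (auto simp: adj_def V_def dim)
  have V_adj: "i \<in> V \<and> j \<in> V \<and> i \<noteq> j" if "adj A i j" "f $ i \<noteq> 0" "f $ j \<noteq> 0" for i j
    using that fF by (auto simp: adj_def V_def dim)
  have R: "equiv D.W R" "equiv D.W R'"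
    unfolding W R_def R'_def using adj_sym symA
    by (auto intro!: equiv_strong_rel simp: sig_def adj_def dim)
  have pos: "x * - sig A i j * y > 0 \<longleftrightarrow> A $$ (i, j) * x * y > 0" for x y i j
    using signed_edge_pos_iff[of x A i j "- y"] by simp
  have domains: "card (D.W // R) = card {p \<in> {..<m}. \<mu>' p < l} + card {p \<in> {..<m}. \<mu>' p = l}"
    "card (D.W // R') = card {p \<in> {..<m}. \<mu>' p > l} + card {p \<in> {..<m}. \<mu>' p = l}"
  proof -
    have edges: "(i, j) \<in> R" if "i \<in> V" "j \<in> V" "i \<noteq> j" "A $$ (i, j) * f $ i * f $ j < 0" for i j
      unfolding R_def using that by (intro edge_in_strong_rel adj_V) (auto simp: signed_edge_pos_iff)
    have edges': "(i, j) \<in> R'" if "i \<in> V" "j \<in> V" "i \<noteq> j" "A $$ (i, j) * f $ i * f $ j > 0" for i j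
    proof -
      have "adj A i j" using that by (intro adj_V) auto
      moreover have "f $ i * - sig A i j * f $ j > 0" using that(4) unfolding pos .
      ultimately show ?thesis unfolding R'_def by (rule edge_in_strong_rel)
    qed
    have gen: "\<forall>(i, j)\<in>R. h i = h j"
      if "\<And>i j. \<lbrakk>i \<in> V; j \<in> V; i \<noteq> j; A $$ (i, j) * f $ i * f $ j < 0\<rbrakk> \<Longrightarrow> h i = h j" for h :: "nat \<Rightarrow> real"
      unfolding R_def
    proof (rule const_on_strong_rel)
      fix i j assume "adj A i j" "f $ i * sig A i j * f $ j > 0"
      then have "A $$ (i, j) * f $ i * f $ j < 0" "adj A i j" by (simp_all only: signed_edge_pos_iff)
      moreover from this have "f $ i \<noteq> 0" "f $ j \<noteq> 0" by auto
      ultimately show "h i = h j" using V_adj that by blast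
    qed
    have gen': "\<forall>(i, j)\<in>R'. h i = h j"
      if "\<And>i j. \<lbrakk>i \<in> V; j \<in> V; i \<noteq> j; A $$ (i, j) * f $ i * f $ j > 0\<rbrakk> \<Longrightarrow> h i = h j" for h :: "nat \<Rightarrow> real"
      unfolding R'_def
    proof (rule const_on_strong_rel)
      fix i j assume "adj A i j" "f $ i * - sig A i j * f $ j > 0"
      then have "A $$ (i, j) * f $ i * f $ j > 0" "adj A i j" by (simp_all only: pos)
      moreover from this have "f $ i \<noteq> 0" "f $ j \<noteq> 0" by auto
      ultimately show "h i = h j" using V_adj that by blast
    qed
    show "card (D.W // R) = card {p \<in> {..<m}. \<mu>' p < l} + card {p \<in> {..<m}. \<mu>' p = l}"
      by (rule D.card_domains(1)[OF R edges edges' gen gen'])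
    show "card (D.W // R') = card {p \<in> {..<m}. \<mu>' p > l} + card {p \<in> {..<m}. \<mu>' p = l}"
      by (rule D.card_domains(2)[OF R edges edges' gen gen'])
  qed

  have sub: "V \<subseteq> {..<n}" by (auto simp: V_def)
  have above: "card {p \<in> {..<m}. \<mu>' p > l} \<le> card {p \<in> {..<n}. \<mu> p > l}"
    by (rule B.interlacing_above[OF basis_V sub])
  have below: "card {p \<in> {..<m}. \<mu>' p < l} \<le> card {p \<in> {..<n}. \<mu> p < l}"
    by (rule B.interlacing_below[OF basis_V sub])
  \<comment> \<open>A deleted vertex has only zeros of \<open>f\<close> as neighbours, and every
    eigenvector for \<open>l\<close> on \<open>V\<close> vanishes at the zeros of \<open>f\<close>
    in \<open>V\<close>.\<close>
  have equal: "card {p \<in> {..<m}. \<mu>' p = l} \<le> card {p \<in> {..<n}. \<mu> p = l}"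
  proof (rule B.card_eigenvalue_le_of_extension[OF basis_V sub])
    fix g i assume g: "\<And>i. i \<in> V \<Longrightarrow> (\<Sum>j\<in>V. A $$ (i, j) * g j) = l * g i" and i: "i \<in> {..<n} - V"
    show "(\<Sum>j\<in>V. A $$ (i, j) * g j) = 0"
    proof (intro sum.neutral ballI)
      fix j assume j: "j \<in> V"
      show "A $$ (i, j) * g j = 0"
      proof (cases "A $$ (i, j) = 0")
        case False
        then have "adj A i j" using i j by (auto simp: adj_def V_def dim)
        then have "f $ j = 0" using i by (auto simp: V_def F_def zero_nbhd_set_def)
        then show ?thesis using D.eigenfunction_zero[OF g, of j] j by simp
      qed simp
    qed
  qed

  let ?ls = "eigvals_list A"
  have ls: "sorted ?ls" "length ?ls = n"
    unfolding eigvals_list_eqI[OF char_A] by simp_all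
  have kr: "k - 1 < n" "k + r - 1 \<le> n" using assms(4-6) by auto
  \<comment> \<open>List positions start at 0: the block of entries equal to \<open>l\<close> begins
    at position \<open>k - 1\<close> and ends just before \<open>k + r - 1\<close>.\<close>
  have lt: "?ls ! i < l" if "i < k - 1" for i
  proof -
    have "?ls ! i \<le> ?ls ! (k - 2)" using that kr ls by (intro sorted_nth_mono) auto
    also have "\<dots> < l" using assms(8) that by (simp add: l_def)
    finally show ?thesis .
  qed
  have eq: "?ls ! i = l" if "k - 1 \<le> i" "i < k + r - 1" for i
    using assms(7)[rule_format, of "Suc i"] that by (simp add: l_def)
  have gt: "?ls ! i > l" if "k + r - 1 \<le> i" "i < n" for i
  proof -
    have "l < ?ls ! (k + r - 1)" using assms(9) that by (simp add: l_def)
    also have "\<dots> \<le> ?ls ! i" using that ls by (intro sorted_nth_mono) auto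
    finally show ?thesis .
  qed
  have trich: "i < k - 1 \<or> k - 1 \<le> i \<and> i < k + r - 1 \<or> k + r - 1 \<le> i" for i by linarith
  have ls_lt: "?ls ! i < l \<longleftrightarrow> i < k - 1" and ls_eq: "?ls ! i = l \<longleftrightarrow> k - 1 \<le> i \<and> i < k + r - 1"
    if "i < n" for i
    using trich[of i] lt[of i] eq[of i] gt[of i] that by auto
  have "{i. i < n \<and> ?ls ! i < l} = {..<k - 1}"
    using ls_lt kr by auto
  then have n_lt: "card {p \<in> {..<n}. \<mu> p < l} = k - 1"
    using card_eigvals_list[OF char_A, of "\<lambda>x. x < l"] by simp
  have "i < n \<and> ?ls ! i = l \<longleftrightarrow> i \<in> {k - 1..<k + r - 1}" for i
    using ls_eq[of i] kr by auto
  then have "{i. i < n \<and> ?ls ! i = l} = {k - 1..<k + r - 1}" by blast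
  then have n_eq: "card {p \<in> {..<n}. \<mu> p = l} = r"
    using card_eigvals_list[OF char_A, of "\<lambda>x. x = l"] assms(4,5) by simp
  have total: "card V + card F = n"
    using card_Diff_subset[OF F(2,1)] card_mono[OF _ F(1)] by (simp add: V_def)

  define N where "N = card {p \<in> {..<n}. \<mu> p > l}"
  define lo where "lo = card {p \<in> {..<m}. \<mu>' p < l}"
  define mid where "mid = card {p \<in> {..<m}. \<mu>' p = l}"
  define hi where "hi = card {p \<in> {..<m}. \<mu>' p > l}"
  have rt: "order l (char_poly At) = mid"
    unfolding mid_def by (rule order_char_poly_eq_card[OF char_At])
  have S: "num_strong_nodal_domains A (sig A) (($) f) = lo + mid"
    "num_strong_nodal_domains A (\<lambda>i j. - sig A i j) (($) f) = hi + mid"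
    unfolding num_strong_nodal_domains_def W[symmetric] R_def[symmetric] R'_def[symmetric]
    by (simp_all add: domains lo_def mid_def hi_def)
  have arith: "hi \<le> N" "lo \<le> k - 1" "mid \<le> r" "k - 1 + r + N = n" "lo + mid + hi + card F = n"
    unfolding N_def lo_def mid_def hi_def
    using above below[unfolded n_lt] equal[unfolded n_eq] D.card_trichotomy[of l] total
      B.card_trichotomy[of l, unfolded n_lt n_eq card_lessThan] by linarith+
  \<comment> \<open>The witnesses are the index drops: \<open>c1 = N - hi\<close> above
    \<open>l\<close> and \<open>c2 = k - 1 - lo\<close> below it. Interlacing keeps the natural
    subtractions exact.\<close>
  have main: "(N - hi) + (k - 1 - lo) + (r - mid) = card F"
    "int (lo + mid) = int (k + r - 1) - int (card F) + int (N - hi)"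
    "int (hi + mid) = int (n - k + 1) - int (card F) + int (k - 1 - lo)"
    using arith assms(4,5) by auto
  then have "\<exists>c1 c2 :: nat. c1 + c2 + (r - mid) = card F \<and>
      int (lo + mid) = int (k + r - 1) - int (card F) + int c1 \<and>
      int (hi + mid) = int (n - k + 1) - int (card F) + int c2" by blast
  moreover have "lo + mid = k + r - 1 \<and> hi + mid = n - k + 1" if "F = {}"
    using main that by auto
  ultimately show ?thesis
    unfolding Let_def l_def[symmetric] F_def[symmetric] At_def[symmetric] rt S
    using arith(3) by blast
qed

end
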